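(* Fix $r\ge1$ and a constant $C>0$. Consider a sequence of dimensions with $r\ll p_1\ll p_2$ (i.e. $p_1\to\infty$ and $p_1/p_2\to0$), deterministic matrices $X\in\mathbb{R}^{p_1\times p_2}$ of rank $r$ with $\sigma_r(X)\ge C(p_2/\sqrt{p_1})$, and random matrices $E\in\mathbb{R}^{p_1\times p_2}$ with independent standard normal entries. Let $\hat X=X+E$, and let $V,\hat V\in\mathbb{R}^{p_2\times r}$ be the matrices of leading $r$ right singular vectors of $X$ and $\hat X$. Then there exists a constant $C_r>0$ such that with high probability (i.e. with probability tending to $1$ along the sequence) $$\|\hat V-VW_V\|_{2\to\infty}\le C_r\left(\tfrac{\log(p_2)}{\sigma_r(X)}\right)\left(1+\left(\tfrac{p_1}{\sigma_r(X)}\right)+\left(\tfrac{\sqrt{p_1}}{\log(p_2)}\right)\|V\|_{2\to\infty}\right).$$ If in addition $\sigma_r(X)\ge c\,p_1$ and $\|V\|_{2\to\infty}\le c_r/\sqrt{p_2}$ for some constants $c,c_r>0$, then (for a possibly different constant $C_r>0$) with high probability $$\|\hat V-VW_V\|_{2\to\infty}\le C_r\left(\tfrac{\log(p_2)}{\sigma_r(X)}\right).$$ Moreover, the lower bound $\tfrac{1}{\sqrt{p_2}}\|\sin\Theta(\hat V,V)\|_2\le\|\hat V-VW_V\|_{2\to\infty}$ always holds.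
   Context: $\sigma_1(M)\ge\sigma_2(M)\ge\cdots$ denote the singular values of a matrix $M$, $\|\cdot\|_2$ is the spectral norm, and $\|A\|_{2\to\infty}:=\sup_{\|x\|_2=1}\|Ax\|_\infty$. The matrices $V,\hat V$ have orthonormal columns, corresponding to the $r$ largest singular values of $X$ and $\hat X$, respectively. The constant $C_r$ may depend on $r$ (and on the fixed constants $C$, $c$, $c_r$ in the hypotheses) but not on $p_1,p_2$, $X$. $W_V$ is the Frobenius-optimal Procrustes matrix: if $V^\top\hat V=W_1\Sigma_VW_2^\top$ is a singular value decomposition of the $r\times r$ matrix $V^\top\hat V$, then $W_V:=W_1W_2^\top$. $\Theta(\hat V,V):=\mathrm{diag}(\cos^{-1}(\sigma_1(V^\top\hat V)),\dots,\cos^{-1}(\sigma_r(V^\top\hat V)))$ is the diagonal matrix of canonical angles, and $\sin\Theta(\hat V,V)$ is obtained by applying $\sin$ to the diagonal entries. *)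

theory Defs
  imports
    "HOL-Probability.Probability"
    "Jordan_Normal_Form.Char_Poly"
    "Jordan_Normal_Form.DL_Rank"
begin

definition norm2_vec :: "real vec \<Rightarrow> real" where
  "norm2_vec x = sqrt (\<Sum>i<dim_vec x. (vec_index x i)\<^sup>2)"

definition norm_inf_vec :: "real vec \<Rightarrow> real" where
  "norm_inf_vec x = Max ((\<lambda>i. \<bar>vec_index x i\<bar>) ` {..<dim_vec x})"

definition unit_vecs :: "nat \<Rightarrow> real vec set" where
  "unit_vecs n = {x \<in> carrier_vec n. norm2_vec x = 1}"

definition spectral_norm :: "real mat \<Rightarrow> real" where
  "spectral_norm A = (SUP x\<in>unit_vecs (dim_col A). norm2_vec (A *\<^sub>v x))"

definition two_to_inf_norm :: "real mat \<Rightarrow> real" where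
  "two_to_inf_norm A = (SUP x\<in>unit_vecs (dim_col A). norm_inf_vec (A *\<^sub>v x))"

(* Square roots of the eigenvalues of A^T A, with multiplicity, in decreasing order.
   Indices start at 1 and are meaningful up to dim_col A. *)
definition singular_value :: "nat \<Rightarrow> real mat \<Rightarrow> real" where
  "singular_value k A =
     sqrt (rev (sorted_list_of_multiset (proots (char_poly (A\<^sup>T * A)))) ! (k - 1))"

(* Not the library constant orthogonal_mat, which only asks for orthogonal non-zero columns. *)
definition orthonormal_mat :: "nat \<Rightarrow> real mat \<Rightarrow> bool" where
  "orthonormal_mat n Q \<longleftrightarrow> Q \<in> carrier_mat n n \<and> Q\<^sup>T * Q = 1\<^sub>m n"

(* Full singular value decomposition A = U S W^T. *)
definition is_svd :: "real mat \<Rightarrow> real mat \<Rightarrow> real mat \<Rightarrow> real mat \<Rightarrow> bool" where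
  "is_svd A U S W \<longleftrightarrow>
     orthonormal_mat (dim_row A) U \<and> orthonormal_mat (dim_col A) W \<and>
     S \<in> carrier_mat (dim_row A) (dim_col A) \<and> diagonal_mat S \<and>
     (\<forall>i < min (dim_row A) (dim_col A). 0 \<le> S $$ (i, i)) \<and>
     (\<forall>j < min (dim_row A) (dim_col A). \<forall>i \<le> j. S $$ (j, j) \<le> S $$ (i, i)) \<and>
     A = U * S * W\<^sup>T"

(* Hence the two descriptions of singular values used here agree. *)
lemma singular_value_svd:
  assumes svd: "is_svd A U S W" and k: "k < min (dim_row A) (dim_col A)"
  shows "singular_value (Suc k) A = S $$ (k, k)"
proof -
  define m n where "m = dim_row A" and "n = dim_col A"
  note mn = m_def[symmetric] n_def[symmetric]
  have U: "U \<in> carrier_mat m m" "U\<^sup>T * U = 1\<^sub>m m"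
    and W: "W \<in> carrier_mat n n" "W\<^sup>T * W = 1\<^sub>m n"
    and S: "S \<in> carrier_mat m n" and dS: "diagonal_mat S"
    and nn: "\<And>i. i < min m n \<Longrightarrow> 0 \<le> S $$ (i, i)"
    and dec: "\<And>i j. j < min m n \<Longrightarrow> i \<le> j \<Longrightarrow> S $$ (j, j) \<le> S $$ (i, i)"
    and A: "A = U * S * W\<^sup>T"
    using svd unfolding is_svd_def orthonormal_mat_def mn by auto
  define D where "D = S\<^sup>T * S"
  have D: "D \<in> carrier_mat n n" using S by (simp add: D_def)
  have WW: "W * W\<^sup>T = 1\<^sub>m n"
    using mat_mult_left_right_inverse[of "W\<^sup>T" n W] W by simp
  define P Q where "P = S * W\<^sup>T" and "Q = W * S\<^sup>T"
  have PQ: "P \<in> carrier_mat m n" "Q \<in> carrier_mat n m"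
    using S W by (auto simp: P_def Q_def)
  have AP: "A = U * P"
    unfolding A P_def by (rule assoc_mult_mat[of _ m m _ n _ n]) (use U W S in auto)
  have "P\<^sup>T = Q"
    unfolding P_def Q_def by (subst transpose_mult[of _ m n _ n]) (use W S in auto)
  hence "A\<^sup>T = Q * U\<^sup>T"
    unfolding AP by (subst transpose_mult[of _ m m _ n]) (use U PQ in auto)
  hence "A\<^sup>T * A = Q * U\<^sup>T * (U * P)" using AP by simp
  also have "\<dots> = Q * (U\<^sup>T * (U * P))"
    by (rule assoc_mult_mat[of _ n m _ m _ n]) (use U PQ in auto)
  also have "U\<^sup>T * (U * P) = U\<^sup>T * U * P"
    by (rule assoc_mult_mat[of _ m m _ m _ n, symmetric]) (use U PQ in auto)
  also have "\<dots> = P" using U PQ by simp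
  also have "Q * P = W * (S\<^sup>T * P)"
    unfolding Q_def by (rule assoc_mult_mat[of _ n n _ m _ n]) (use S W PQ in auto)
  also have "S\<^sup>T * P = D * W\<^sup>T"
    unfolding P_def D_def by (rule assoc_mult_mat[of _ n m _ n _ n, symmetric]) (use S W in auto)
  also have "W * (D * W\<^sup>T) = W * D * W\<^sup>T"
    by (rule assoc_mult_mat[of _ n n _ n _ n, symmetric]) (use D W in auto)
  finally have eq: "A\<^sup>T * A = W * D * W\<^sup>T" .
  have Dij: "D $$ (i,j) = (if i = j \<and> i < m then (S $$ (i,i))\<^sup>2 else 0)" if ij: "i < n" "j < n" for i j
  proof -
    have "D $$ (i,j) = (\<Sum>l<m. S $$ (l,i) * S $$ (l,j))"
      using S ij by (simp add: D_def scalar_prod_def atLeast0LessThan)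
    also have "\<dots> = (\<Sum>l<m. if l = i then (if i = j then (S $$ (i,i))\<^sup>2 else 0) else 0)"
      using dS S ij by (intro sum.cong) (auto simp: diagonal_mat_def power2_eq_square)
    finally show ?thesis by simp
  qed
  have "similar_mat (A\<^sup>T * A) D"
    unfolding similar_mat_def similar_mat_wit_def Let_def
    using eq D W WW by (intro exI[of _ W] exI[of _ "W\<^sup>T"]) auto
  hence "char_poly (A\<^sup>T * A) = char_poly D" by (rule char_poly_similar)
  also have "\<dots> = (\<Prod>a\<leftarrow>diag_mat D. [:- a, 1:])"
    by (rule char_poly_upper_triangular[OF D]) (use D Dij in \<open>auto simp: upper_triangular_def\<close>)
  finally have cp: "char_poly (A\<^sup>T * A) = (\<Prod>a\<leftarrow>diag_mat D. [:- a, 1:])" .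
  have pr: "proots (\<Prod>a\<leftarrow>xs. [:- a, 1:]) = mset xs" for xs :: "real list"
  proof (induction xs)
    case (Cons a xs)
    have "(\<Prod>a\<leftarrow>xs. [:- a, 1:]) \<noteq> 0"
      by (auto simp: prod_list_zero_iff)
    moreover have "proots [:-a,1:] = {#a#}" using proots_linear_factor[of "- a"] by simp
    ultimately show ?case using Cons by (simp add: proots_mult del: mult_pCons_left)
  qed auto
  have "sorted_wrt (\<ge>) (diag_mat D)"
    unfolding sorted_wrt_iff_nth_less
    using D by (auto simp: diag_mat_def Dij intro!: power_mono dec nn)
  hence "sorted (rev (diag_mat D))" by (simp add: sorted_wrt_rev)
  hence "sort (diag_mat D) = rev (diag_mat D)"
    by (intro properties_for_sort) auto
  hence "singular_value (Suc k) A = sqrt (diag_mat D ! k)"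
    by (simp add: singular_value_def cp pr)
  also have "\<dots> = S $$ (k,k)"
    using D k nn[of k] by (simp add: diag_mat_def Dij mn)
  finally show ?thesis .
qed

definition leading_right_singular_vectors :: "nat \<Rightarrow> real mat \<Rightarrow> real mat \<Rightarrow> bool" where
  "leading_right_singular_vectors r A V \<longleftrightarrow>
     (\<exists>U S W. is_svd A U S W \<and> V = mat (dim_col A) r (\<lambda>(i, j). W $$ (i, j)))"

(* A relation, since the matrix is determined uniquely only when V^T Vh is invertible. *)
definition is_procrustes :: "real mat \<Rightarrow> real mat \<Rightarrow> real mat \<Rightarrow> bool" where
  "is_procrustes V Vh W \<longleftrightarrow> (\<exists>W1 S W2. is_svd (V\<^sup>T * Vh) W1 S W2 \<and> W = W1 * W2\<^sup>T)"

definition sin_Theta :: "real mat \<Rightarrow> real mat \<Rightarrow> real mat" where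
  "sin_Theta Vh V = mat (dim_col V) (dim_col V)
     (\<lambda>(i, j). if i = j then sin (arccos (singular_value (i + 1) (V\<^sup>T * Vh))) else 0)"

(* Probability tending to 1. The event is not assumed measurable: it has to contain measurable
   events of probability tending to 1, and these two readings agree for measurable events. *)
definition with_high_probability ::
    "(nat \<Rightarrow> 'a measure) \<Rightarrow> (nat \<Rightarrow> 'a \<Rightarrow> bool) \<Rightarrow> bool" where
  "with_high_probability M P \<longleftrightarrow>
     (\<exists>A. (\<forall>n. A n \<in> sets (M n) \<and> (\<forall>\<omega>\<in>A n. P n \<omega>)) \<and>
          (\<lambda>n. measure (M n) (A n)) \<longlonglongrightarrow> 1)"

definition standard_gaussian_matrix ::
    "'a measure \<Rightarrow> nat \<Rightarrow> nat \<Rightarrow> ('a \<Rightarrow> real mat) \<Rightarrow> bool" where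
  "standard_gaussian_matrix M m n E \<longleftrightarrow>
     (\<forall>\<omega>\<in>space M. E \<omega> \<in> carrier_mat m n) \<and>
     prob_space.indep_vars M (\<lambda>_. borel) (\<lambda>ij \<omega>. E \<omega> $$ ij) ({..<m} \<times> {..<n}) \<and>
     (\<forall>i<m. \<forall>j<n. distributed M lborel (\<lambda>\<omega>. E \<omega> $$ (i, j)) std_normal_density)"

(* The standing assumptions along the sequence. Vh and W are arbitrary pointwise choices of the
   singular vectors of X + E and of the Procrustes matrix; no measurability is required of them. *)
definition gaussian_perturbation_model ::
    "nat \<Rightarrow> real \<Rightarrow> (nat \<Rightarrow> 'a measure) \<Rightarrow> (nat \<Rightarrow> nat) \<Rightarrow> (nat \<Rightarrow> nat) \<Rightarrow>
     (nat \<Rightarrow> real mat) \<Rightarrow> (nat \<Rightarrow> 'a \<Rightarrow> real mat) \<Rightarrow>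
     (nat \<Rightarrow> real mat) \<Rightarrow> (nat \<Rightarrow> 'a \<Rightarrow> real mat) \<Rightarrow> (nat \<Rightarrow> 'a \<Rightarrow> real mat) \<Rightarrow> bool" where
  "gaussian_perturbation_model r C M p1 p2 X E V Vh W \<longleftrightarrow>
     filterlim p1 at_top sequentially \<and>
     (\<lambda>n. real (p1 n) / real (p2 n)) \<longlonglongrightarrow> 0 \<and>
     (\<forall>n. prob_space (M n) \<and>
          X n \<in> carrier_mat (p1 n) (p2 n) \<and>
          vec_space.rank (p1 n) (X n) = r \<and>
          C * (real (p2 n) / sqrt (real (p1 n))) \<le> singular_value r (X n) \<and>
          standard_gaussian_matrix (M n) (p1 n) (p2 n) (E n) \<and>
          leading_right_singular_vectors r (X n) (V n) \<and>
          (\<forall>\<omega>\<in>space (M n).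
             leading_right_singular_vectors r (X n + E n \<omega>) (Vh n \<omega>) \<and>
             is_procrustes (V n) (Vh n \<omega>) (W n \<omega>)))"

end

theory Submission
  imports Defs
begin

text \<open>Write $m \times n$ for the dimensions, $\sigma$ for the smallest nonzero singular value of \<open>X\<close>, and \<open>u\<close>, \<open>v\<close>, $\hat s$ for a
leading singular triple of \<open>X + E\<close>. The rows of \<open>X\<close> lie in the span of \<open>V\<close>, so the identity
$\hat s v = (X + E)^T u$ determines \<open>v\<close> up to that span by the noise alone, and
$$v - V W e_k = V (V^T v - W e_k) + \hat s^{-1} (E^T u - V V^T E^T u).$$
Everything that starts with \<open>V\<close> has entries bounded by \<open>two_to_inf_norm V\<close> times a Euclidean norm. The
Procrustes error $V^T v - W e_k$ is quadratic in the subspace distance, hence of order $n / \sigma^2$, and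
$V^T E^T u$ is of order $\sqrt m$ because \<open>V\<close> is deterministic with a fixed number of columns. There remain
the entries of $E^T u$. The component of \<open>u\<close> in the left singular space of \<open>X\<close> meets only fixed Gaussian
linear forms, of size $\log n$. The rest of \<open>u\<close> has length of order $(\sqrt m + n / \sigma) / \sigma$ and is paired with a column
of \<open>E\<close>, of norm at most $\sqrt m \log n$ up to a constant. The hypothesis $\sigma \ge C n / \sqrt m$ bounds $n / \sigma$ by a multiple of
$\sqrt m$, and the sum of these contributions is the asserted rate. This deterministic part is
\<open>entrywise_perturbation_bound\<close>; it relies on Weyl's inequality \<open>weyl_lower\<close> for $\hat s \ge \sigma / 2$ and on
\<open>procrustes_approx\<close>.

The noise enters only through its operator norm, its action on \<open>V\<close>, its entries, and the entries of
its product with the left singular vectors of \<open>X\<close>. After discretising unit spheres by finite norming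
sets (\<open>exists_finite_norming_set\<close>) these are maxima of finitely many linear forms in independent
standard normal variables, so a Chernoff bound and a union bound suffice
(\<open>gaussian_noise_event\<close>).

The lower bound is deterministic: a canonical angle $\theta$ contributes $\sin\theta$ on the left and at least
$2 \sin(\theta / 2)$ to the operator norm of the aligned difference (\<open>sin_Theta_lower_bound\<close>).\<close>

section \<open>Euclidean norm\<close>

lemma norm2_vec_eq_L2_set: "x \<in> carrier_vec n \<Longrightarrow> norm2_vec x = L2_set (vec_index x) {..<n}"
  by (simp add: norm2_vec_def L2_set_def)

lemma norm2_vec_nonneg [simp]: "0 \<le> norm2_vec x"
  by (simp add: norm2_vec_def sum_nonneg)

lemma norm2_vec_sq: "(norm2_vec x)\<^sup>2 = x \<bullet> x"
  by (simp add: norm2_vec_def sum_nonneg scalar_prod_def power2_eq_square atLeast0LessThan)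

lemma norm2_vec_triangle:
  assumes "x \<in> carrier_vec n" "y \<in> carrier_vec n"
  shows "norm2_vec (x + y) \<le> norm2_vec x + norm2_vec y"
proof -
  have "norm2_vec (x + y) = L2_set (\<lambda>i. vec_index x i + vec_index y i) {..<n}"
    using assms by (subst norm2_vec_eq_L2_set[of _ n]) (auto intro!: L2_set_cong)
  also have "\<dots> \<le> L2_set (vec_index x) {..<n} + L2_set (vec_index y) {..<n}"
    by (rule L2_set_triangle_ineq)
  finally show ?thesis using assms by (simp add: norm2_vec_eq_L2_set)
qed

lemma norm2_vec_smult: "norm2_vec (c \<cdot>\<^sub>v x) = \<bar>c\<bar> * norm2_vec x"
  by (simp add: norm2_vec_def power_mult_distrib real_sqrt_mult flip: sum_distrib_left)

lemma norm2_vec_uminus: "norm2_vec (- x) = norm2_vec x"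
  by (simp add: norm2_vec_def)

lemma norm2_vec_minus_le:
  assumes "x \<in> carrier_vec n" "y \<in> carrier_vec n"
  shows "norm2_vec (x - y) \<le> norm2_vec x + norm2_vec y"
  using norm2_vec_triangle[of x n "- y"] assms
  by (simp add: norm2_vec_uminus minus_add_uminus_vec[of x n y])

lemma scalar_prod_le_norm2_vec:
  assumes "x \<in> carrier_vec n" "y \<in> carrier_vec n"
  shows "\<bar>x \<bullet> y\<bar> \<le> norm2_vec x * norm2_vec y"
proof -
  have "\<bar>x \<bullet> y\<bar> \<le> (\<Sum>i<n. \<bar>vec_index x i\<bar> * \<bar>vec_index y i\<bar>)"
    using assms by (auto simp: scalar_prod_def atLeast0LessThan abs_mult[symmetric] intro!: order.trans[OF sum_abs])
  also have "\<dots> \<le> norm2_vec x * norm2_vec y"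
    using assms by (simp add: norm2_vec_eq_L2_set L2_set_mult_ineq)
  finally show ?thesis .
qed

lemma abs_vec_index_le_norm2_vec:
  assumes "i < dim_vec x" shows "\<bar>vec_index x i\<bar> \<le> norm2_vec x"
proof -
  have "(vec_index x i)\<^sup>2 \<le> (\<Sum>i<dim_vec x. (vec_index x i)\<^sup>2)"
    by (rule member_le_sum) (use assms in auto)
  thus ?thesis unfolding norm2_vec_def by (metis real_sqrt_abs real_sqrt_le_mono)
qed

lemma norm2_vec_eq_0_iff:
  assumes "x \<in> carrier_vec n" shows "norm2_vec x = 0 \<longleftrightarrow> x = 0\<^sub>v n"
  using assms by (auto simp: norm2_vec_eq_L2_set L2_set_eq_0_iff intro!: eq_vecI)

lemma norm2_vec_zero [simp]: "norm2_vec (0\<^sub>v n) = 0"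
  by (simp add: norm2_vec_def)

lemma norm2_vec_unit_vec: "i < n \<Longrightarrow> norm2_vec (unit_vec n i) = 1"
proof -
  assume i: "i < n"
  have "(norm2_vec (unit_vec n i))\<^sup>2 = 1" using i by (simp add: norm2_vec_sq)
  thus ?thesis by (metis norm2_vec_nonneg power2_eq_1_iff abs_of_nonneg abs_neg_one)
qed

lemma norm2_vec_le_sqrt_sum:
  assumes "x \<in> carrier_vec n" "\<And>i. i < n \<Longrightarrow> \<bar>vec_index x i\<bar> \<le> b" "0 \<le> b"
  shows "norm2_vec x \<le> sqrt n * b"
proof -
  have "(\<Sum>i<n. (vec_index x i)\<^sup>2) \<le> (\<Sum>i<n. b\<^sup>2)"
    using assms(2,3) by (intro sum_mono) (metis abs_ge_zero lessThan_iff power2_abs power_mono)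
  hence "norm2_vec x \<le> sqrt (n * b\<^sup>2)" using assms(1) by (simp add: norm2_vec_def)
  thus ?thesis using assms(3) by (simp add: real_sqrt_mult)
qed

text \<open>The factor \<open>r\<close> is affordable because the number of columns is a fixed constant in the application;
in exchange, operator bounds on $n \times r$ matrices can be proved one column at a time.\<close>

lemma norm2_mult_mat_vec_le_sum_cols:
  assumes A: "A \<in> carrier_mat n r" and x: "x \<in> carrier_vec r"
    and b: "\<And>k. k < r \<Longrightarrow> norm2_vec (col A k) \<le> b"
  shows "norm2_vec (A *\<^sub>v x) \<le> r * b * norm2_vec x"
proof -
  let ?S = "\<lambda>q. vec n (\<lambda>j. \<Sum>k<q. A $$ (j,k) * vec_index x k)"
  have "norm2_vec (?S q) \<le> (\<Sum>k<q. norm2_vec (col A k) * \<bar>vec_index x k\<bar>)" if "q \<le> r" for q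
    using that
  proof (induction q)
    case (Suc q)
    have eq: "?S (Suc q) = ?S q + vec_index x q \<cdot>\<^sub>v col A q"
      using A Suc.prems by (auto intro!: eq_vecI)
    have "norm2_vec (?S (Suc q)) \<le> norm2_vec (?S q) + norm2_vec (vec_index x q \<cdot>\<^sub>v col A q)"
      unfolding eq by (rule norm2_vec_triangle[of _ n]) (use A in auto)
    with Suc show ?case by (simp add: norm2_vec_smult mult.commute)
  qed (simp add: norm2_vec_def)
  from this[of r] have "norm2_vec (?S r) \<le> (\<Sum>k<r. norm2_vec (col A k) * \<bar>vec_index x k\<bar>)" by simp
  also have "\<dots> \<le> (\<Sum>k<r. b * norm2_vec x)"
    using b x by (intro sum_mono mult_mono abs_vec_index_le_norm2_vec) (auto intro: order.trans[OF norm2_vec_nonneg b])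
  also have "?S r = A *\<^sub>v x" using A x by (auto intro!: eq_vecI simp: scalar_prod_def atLeast0LessThan)
  finally show ?thesis by simp
qed

section \<open>Matrices with orthonormal columns\<close>

lemma norm2_orthonormal_cols:
  assumes V: "V \<in> carrier_mat n r" "V\<^sup>T * V = 1\<^sub>m r" and x: "x \<in> carrier_vec r"
  shows "norm2_vec (V *\<^sub>v x) = norm2_vec x"
proof -
  have "(norm2_vec (V *\<^sub>v x))\<^sup>2 = (V\<^sup>T *\<^sub>v (V *\<^sub>v x)) \<bullet> x"
    unfolding norm2_vec_sq by (rule transpose_vec_mult_scalar[symmetric]) (use V x in auto)
  also have "V\<^sup>T *\<^sub>v (V *\<^sub>v x) = (V\<^sup>T * V) *\<^sub>v x"
    by (rule assoc_mult_mat_vec[symmetric]) (use V x in auto)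
  finally have "(norm2_vec (V *\<^sub>v x))\<^sup>2 = (norm2_vec x)\<^sup>2" using V x by (simp add: norm2_vec_sq)
  thus ?thesis by (simp add: power2_eq_iff_nonneg)
qed

lemma transpose_orthonormal_cols_cancel:
  fixes V :: "real mat"
  assumes V: "V \<in> carrier_mat n r" "V\<^sup>T * V = 1\<^sub>m r" and x: "x \<in> carrier_vec r"
  shows "V\<^sup>T *\<^sub>v (V *\<^sub>v x) = x"
proof -
  have "V\<^sup>T *\<^sub>v (V *\<^sub>v x) = (V\<^sup>T * V) *\<^sub>v x"
    by (rule assoc_mult_mat_vec[symmetric]) (use V x in auto)
  thus ?thesis using one_mult_mat_vec[OF x] V(2) by simp
qed

text \<open>Pythagoras: \<open>V *\<^sub>v (V\<^sup>T *\<^sub>v y)\<close> is the orthogonal projection of \<open>y\<close> onto the column space of \<open>V\<close>.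
The difference \<open>y - V *\<^sub>v (V\<^sup>T *\<^sub>v y)\<close> is called the residual of \<open>y\<close> below.\<close>

lemma norm2_residual_sq:
  assumes V: "V \<in> carrier_mat n r" "V\<^sup>T * V = 1\<^sub>m r" and y: "y \<in> carrier_vec n"
  shows "(norm2_vec (y - V *\<^sub>v (V\<^sup>T *\<^sub>v y)))\<^sup>2 = (norm2_vec y)\<^sup>2 - (norm2_vec (V\<^sup>T *\<^sub>v y))\<^sup>2"
proof -
  define c where "c = V\<^sup>T *\<^sub>v y"
  have c: "c \<in> carrier_vec r" using V y by (simp add: c_def)
  have Vc: "V *\<^sub>v c \<in> carrier_vec n" using V c by simp
  have yVc: "y \<bullet> (V *\<^sub>v c) = c \<bullet> c"
    using transpose_vec_mult_scalar[OF V(1) c y] by (simp add: c_def)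
  have "(V *\<^sub>v c) \<bullet> (V *\<^sub>v c) = c \<bullet> c"
    using norm2_orthonormal_cols[OF V c] by (simp flip: norm2_vec_sq)
  moreover have "(V *\<^sub>v c) \<bullet> y = c \<bullet> c" using yVc comm_scalar_prod[OF Vc y] by simp
  ultimately have "(y - V *\<^sub>v c) \<bullet> (y - V *\<^sub>v c) = y \<bullet> y - c \<bullet> c"
    using y Vc yVc by (simp add: minus_scalar_prod_distrib[of _ n] scalar_prod_minus_distrib[of _ n])
  thus ?thesis by (simp add: norm2_vec_sq c_def)
qed

lemma norm2_residual_le:
  assumes V: "V \<in> carrier_mat n r" "V\<^sup>T * V = 1\<^sub>m r" and y: "y \<in> carrier_vec n"
  shows "norm2_vec (y - V *\<^sub>v (V\<^sup>T *\<^sub>v y)) \<le> norm2_vec y"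
proof (rule power2_le_imp_le)
  show "(norm2_vec (y - V *\<^sub>v (V\<^sup>T *\<^sub>v y)))\<^sup>2 \<le> (norm2_vec y)\<^sup>2"
    unfolding norm2_residual_sq[OF V y] by simp
qed simp

lemma norm2_transpose_orthonormal_cols_le:
  assumes V: "V \<in> carrier_mat n r" "V\<^sup>T * V = 1\<^sub>m r" and y: "y \<in> carrier_vec n"
  shows "norm2_vec (V\<^sup>T *\<^sub>v y) \<le> norm2_vec y"
proof (rule power2_le_imp_le)
  show "(norm2_vec (V\<^sup>T *\<^sub>v y))\<^sup>2 \<le> (norm2_vec y)\<^sup>2"
    using norm2_residual_sq[OF V y] zero_le_power2[of "norm2_vec (y - V *\<^sub>v (V\<^sup>T *\<^sub>v y))"] by linarith
qed simp

text \<open>A matrix and its transpose have the same operator norm; the proof pairs \<open>E\<^sup>T *\<^sub>v y\<close> with itself.\<close>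

lemma norm2_transpose_mult_le:
  assumes E: "E \<in> carrier_mat m n" and b: "\<And>x. x \<in> carrier_vec n \<Longrightarrow> norm2_vec (E *\<^sub>v x) \<le> b * norm2_vec x"
    and y: "y \<in> carrier_vec m" and b0: "0 \<le> b"
  shows "norm2_vec (E\<^sup>T *\<^sub>v y) \<le> b * norm2_vec y"
proof -
  let ?z = "E\<^sup>T *\<^sub>v y"
  have z: "?z \<in> carrier_vec n" using E y by simp
  have "norm2_vec ?z * norm2_vec ?z = y \<bullet> (E *\<^sub>v ?z)"
    using transpose_vec_mult_scalar[OF E z y] norm2_vec_sq[of ?z] by (simp add: power2_eq_square)
  also have "\<dots> \<le> norm2_vec y * norm2_vec (E *\<^sub>v ?z)"
    using scalar_prod_le_norm2_vec[of y m "E *\<^sub>v ?z"] E y z by auto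
  also have "\<dots> \<le> norm2_vec y * (b * norm2_vec ?z)" by (intro mult_left_mono b z) simp
  finally have "norm2_vec ?z * norm2_vec ?z \<le> (b * norm2_vec y) * norm2_vec ?z" by (simp add: mult_ac)
  thus ?thesis using b0 by (cases "norm2_vec ?z = 0") (auto simp: less_le)
qed

section \<open>Singular value decompositions\<close>

lemma is_svdD:
  assumes "is_svd A U S W" "A \<in> carrier_mat m n"
  shows "U \<in> carrier_mat m m" "U\<^sup>T * U = 1\<^sub>m m" "W \<in> carrier_mat n n" "W\<^sup>T * W = 1\<^sub>m n"
    "S \<in> carrier_mat m n" "\<And>i j. i < m \<Longrightarrow> j < n \<Longrightarrow> i \<noteq> j \<Longrightarrow> S $$ (i,j) = 0"
    "\<And>i. i < min m n \<Longrightarrow> 0 \<le> S $$ (i, i)"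
    "\<And>i j. j < min m n \<Longrightarrow> i \<le> j \<Longrightarrow> S $$ (j, j) \<le> S $$ (i, i)"
    "A = U * S * W\<^sup>T"
  using assms unfolding is_svd_def orthonormal_mat_def diagonal_mat_def by auto

lemma is_svd_transpose:
  assumes svd: "is_svd A U S W" shows "is_svd A\<^sup>T W S\<^sup>T U"
proof -
  define m n where "m = dim_row A" and "n = dim_col A"
  have A: "A \<in> carrier_mat m n" by (simp add: m_def n_def)
  note D = is_svdD[OF svd A]
  have "A\<^sup>T = (U * S * W\<^sup>T)\<^sup>T" using D(9) by simp
  also have "\<dots> = W * (U * S)\<^sup>T" by (subst transpose_mult[of _ m n _ n]) (use D(1-5) in auto)
  also have "(U * S)\<^sup>T = S\<^sup>T * U\<^sup>T" by (rule transpose_mult) (use D(1-5) in auto)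
  also have "W * (S\<^sup>T * U\<^sup>T) = W * S\<^sup>T * U\<^sup>T" by (rule assoc_mult_mat[symmetric, of _ n n _ m _ m]) (use D(1-5) in auto)
  finally have "A\<^sup>T = W * S\<^sup>T * U\<^sup>T" .
  thus ?thesis using D A svd unfolding is_svd_def orthonormal_mat_def diagonal_mat_def by (auto simp: min.commute)
qed

lemma svd_mult_vec:
  assumes svd: "is_svd A U S W" and A: "A \<in> carrier_mat m n" and x: "x \<in> carrier_vec n"
  shows "A *\<^sub>v x = U *\<^sub>v (S *\<^sub>v (W\<^sup>T *\<^sub>v x))"
proof -
  note D = is_svdD[OF svd A]
  have "A *\<^sub>v x = U * S * W\<^sup>T *\<^sub>v x" using D(9) by simp
  also have "\<dots> = U * S *\<^sub>v (W\<^sup>T *\<^sub>v x)" by (rule assoc_mult_mat_vec[of _ m n _ n]) (use D(1-5) x in auto)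
  also have "\<dots> = U *\<^sub>v (S *\<^sub>v (W\<^sup>T *\<^sub>v x))" by (rule assoc_mult_mat_vec[of _ m m _ n]) (use D(1-5) x in auto)
  finally show ?thesis .
qed

lemma svd_diag_mult_index:
  assumes svd: "is_svd A U S W" and A: "A \<in> carrier_mat m n" and z: "z \<in> carrier_vec n" and i: "i < m"
  shows "vec_index (S *\<^sub>v z) i = (if i < n then S $$ (i,i) * vec_index z i else 0)"
proof -
  note D = is_svdD[OF svd A]
  have "vec_index (S *\<^sub>v z) i = (\<Sum>k<n. S $$ (i,k) * vec_index z k)"
    using D(5) z i by (simp add: scalar_prod_def atLeast0LessThan)
  also have "\<dots> = (\<Sum>k<n. if k = i then S $$ (i,i) * vec_index z i else 0)"
    using D(6) i by (intro sum.cong) auto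
  finally show ?thesis by simp
qed

lemma mat_unit_vec_col:
  assumes A: "(A :: real mat) \<in> carrier_mat n m" and k: "k < m"
  shows "A *\<^sub>v unit_vec m k = col A k"
proof (rule eq_vecI)
  fix i assume "i < dim_vec (col A k)"
  hence i: "i < n" using A by simp
  hence "vec_index (A *\<^sub>v unit_vec m k) i = row A i \<bullet> unit_vec m k" using A by simp
  also have "\<dots> = vec_index (row A i) k" by (rule scalar_prod_right_unit[OF k])
  finally show "vec_index (A *\<^sub>v unit_vec m k) i = vec_index (col A k) i" using A i k by simp
qed (use A in simp)

lemma svd_right_vector:
  assumes svd: "is_svd A U S W" and A: "A \<in> carrier_mat m n" and k: "k < min m n"
  shows "A *\<^sub>v col W k = S $$ (k,k) \<cdot>\<^sub>v col U k"
proof -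
  note D = is_svdD[OF svd A]
  have c: "col W k \<in> carrier_vec n" using D(1-5) by auto
  have "W\<^sup>T *\<^sub>v col W k = col (W\<^sup>T * W) k" by (rule col_mult2[symmetric, of _ n n _ n]) (use D(1-5) k in auto)
  also have "\<dots> = unit_vec n k" using D(1-5) k by simp
  finally have "W\<^sup>T *\<^sub>v col W k = unit_vec n k" .
  moreover have "S *\<^sub>v unit_vec n k = S $$ (k,k) \<cdot>\<^sub>v unit_vec m k"
  proof (rule eq_vecI)
    fix i assume "i < dim_vec (S $$ (k,k) \<cdot>\<^sub>v unit_vec m k)"
    hence i: "i < m" by simp
    have "vec_index (S *\<^sub>v unit_vec n k) i = (if i < n then S $$ (i,i) * vec_index (unit_vec n k) i else 0)"
      by (rule svd_diag_mult_index[OF svd A unit_vec_carrier i])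
    also have "\<dots> = S $$ (k,k) * vec_index (unit_vec m k) i"
      using i k by (cases "i = k") auto
    finally show "vec_index (S *\<^sub>v unit_vec n k) i = vec_index (S $$ (k,k) \<cdot>\<^sub>v unit_vec m k) i"
      using i by (simp only: index_smult_vec index_unit_vec)
  qed (use D(1-5) in auto)
  moreover have "U *\<^sub>v (S $$ (k,k) \<cdot>\<^sub>v unit_vec m k) = S $$ (k,k) \<cdot>\<^sub>v (U *\<^sub>v unit_vec m k)"
    by (rule mult_mat_vec) (use D(1-5) in auto)
  moreover have "U *\<^sub>v unit_vec m k = col U k"
    by (rule mat_unit_vec_col[OF D(1)]) (use k in simp)
  ultimately show ?thesis using svd_mult_vec[OF svd A c] by simp
qed

lemma svd_left_vector:
  assumes svd: "is_svd A U S W" and A: "A \<in> carrier_mat m n" and k: "k < min m n"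
  shows "A\<^sup>T *\<^sub>v col U k = S $$ (k,k) \<cdot>\<^sub>v col W k"
proof -
  have "A\<^sup>T *\<^sub>v col U k = S\<^sup>T $$ (k,k) \<cdot>\<^sub>v col W k"
    by (rule svd_right_vector[OF is_svd_transpose[OF svd], of n m]) (use A k in auto)
  thus ?thesis using is_svdD(5)[OF svd A] k by simp
qed

text \<open>Together with \<open>svd_lower_bound\<close> this is the part of the Courant--Fischer principle that Weyl's
inequality uses: orthogonality to the first \<open>q\<close> right singular vectors removes the \<open>q\<close> largest
singular values.\<close>

lemma svd_upper_bound:
  assumes svd: "is_svd A U S W" and A: "A \<in> carrier_mat m n" and q: "q < min m n" and x: "x \<in> carrier_vec n"
    and orth: "\<And>i. i < q \<Longrightarrow> col W i \<bullet> x = 0"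
  shows "norm2_vec (A *\<^sub>v x) \<le> S $$ (q,q) * norm2_vec x"
proof -
  note D = is_svdD[OF svd A]
  define z where "z = W\<^sup>T *\<^sub>v x"
  have z: "z \<in> carrier_vec n" using D(3) x by (simp add: z_def)
  have Sz: "S *\<^sub>v z \<in> carrier_vec m" using D(1-5) z by simp
  have z0: "vec_index z i = 0" if "i < q" for i using that orth[of i] D(1-5) q by (simp add: z_def)
  have "(norm2_vec (S *\<^sub>v z))\<^sup>2 = (\<Sum>i<m. (vec_index (S *\<^sub>v z) i)\<^sup>2)"
    using D(5) by (simp add: norm2_vec_def sum_nonneg)
  also have "\<dots> = (\<Sum>i<m. if i < n then (S $$ (i,i) * vec_index z i)\<^sup>2 else 0)"
    by (intro sum.cong refl) (simp add: svd_diag_mult_index[OF svd A z] del: index_mult_mat_vec)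
  also have "\<dots> = (\<Sum>i<min m n. (S $$ (i,i) * vec_index z i)\<^sup>2)"
    by (intro sum.mono_neutral_cong_right) auto
  also have "\<dots> \<le> (\<Sum>i<min m n. (S $$ (q,q) * vec_index z i)\<^sup>2)"
  proof (rule sum_mono)
    fix i assume i: "i \<in> {..<min m n}"
    show "(S $$ (i,i) * vec_index z i)\<^sup>2 \<le> (S $$ (q,q) * vec_index z i)\<^sup>2"
    proof (cases "i < q")
      case False
      thus ?thesis using i D(7)[of i] D(8)[of i q] unfolding power_mult_distrib
        by (intro mult_right_mono power_mono) auto
    qed (simp add: z0)
  qed
  also have "\<dots> \<le> (\<Sum>i<n. (S $$ (q,q) * vec_index z i)\<^sup>2)" by (rule sum_mono2) auto
  also have "\<dots> = (S $$ (q,q) * norm2_vec z)\<^sup>2"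
    using z by (simp add: power_mult_distrib norm2_vec_def sum_nonneg sum_distrib_left)
  finally have "norm2_vec (S *\<^sub>v z) \<le> S $$ (q,q) * norm2_vec z"
    by (rule power2_le_imp_le) (rule mult_nonneg_nonneg[OF D(7)[OF q] norm2_vec_nonneg])
  moreover have "norm2_vec (A *\<^sub>v x) = norm2_vec (S *\<^sub>v z)"
    using norm2_orthonormal_cols[OF D(1,2) Sz] svd_mult_vec[OF svd A x] by (simp add: z_def)
  moreover have "norm2_vec z \<le> norm2_vec x"
    unfolding z_def by (rule norm2_transpose_orthonormal_cols_le) (use D(1-5) x in auto)
  moreover from this have "S $$ (q,q) * norm2_vec z \<le> S $$ (q,q) * norm2_vec x"
    by (rule mult_left_mono) (rule D(7)[OF q])
  ultimately show ?thesis by linarith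
qed

definition leading_cols :: "nat \<Rightarrow> real mat \<Rightarrow> real mat" where
  "leading_cols r W = mat (dim_row W) r (\<lambda>(i, j). W $$ (i, j))"

lemma leading_cols_carrier: "W \<in> carrier_mat n k \<Longrightarrow> leading_cols r W \<in> carrier_mat n r"
  by (simp add: leading_cols_def)

lemma col_leading_cols:
  "k < r \<Longrightarrow> r \<le> dim_col W \<Longrightarrow> col (leading_cols r W) k = col W k"
  by (auto simp: leading_cols_def intro!: eq_vecI)

lemma orthonormal_leading_cols:
  assumes "W \<in> carrier_mat n n" "W\<^sup>T * W = 1\<^sub>m n" "r \<le> n"
  shows "(leading_cols r W)\<^sup>T * leading_cols r W = 1\<^sub>m r"
proof (rule eq_matI)
  fix i j assume ij: "i < dim_row (1\<^sub>m r)" "j < dim_col (1\<^sub>m r)"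
  have c: "leading_cols r W \<in> carrier_mat n r" by (rule leading_cols_carrier[OF assms(1)])
  have "((leading_cols r W)\<^sup>T * leading_cols r W) $$ (i,j) = col (leading_cols r W) i \<bullet> col (leading_cols r W) j"
    using ij c by simp
  also have "\<dots> = col W i \<bullet> col W j" using ij assms by (simp add: col_leading_cols)
  also have "\<dots> = (W\<^sup>T * W) $$ (i,j)" using ij assms(1,3) by simp
  finally show "((leading_cols r W)\<^sup>T * leading_cols r W) $$ (i,j) = (1\<^sub>m r :: real mat) $$ (i,j)"
    using ij assms by simp
qed (auto simp: leading_cols_def)

lemma leading_cols_mult_vec:
  assumes "U \<in> carrier_mat m m" "s \<in> carrier_vec m" "r \<le> m" "\<And>i. r \<le> i \<Longrightarrow> i < m \<Longrightarrow> vec_index s i = 0"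
  shows "U *\<^sub>v s = leading_cols r U *\<^sub>v vec r (vec_index s)"
proof (rule eq_vecI)
  fix i assume "i < dim_vec (leading_cols r U *\<^sub>v vec r (vec_index s))"
  hence i: "i < m" using assms(1) by (simp add: leading_cols_def)
  have "vec_index (U *\<^sub>v s) i = (\<Sum>k<m. U $$ (i,k) * vec_index s k)"
    using assms i by (simp add: scalar_prod_def atLeast0LessThan)
  also have "\<dots> = (\<Sum>k<r. U $$ (i,k) * vec_index s k)"
    using assms(3,4) by (intro sum.mono_neutral_right) auto
  finally show "vec_index (U *\<^sub>v s) i = vec_index (leading_cols r U *\<^sub>v vec r (vec_index s)) i"
    using assms i by (simp add: leading_cols_def scalar_prod_def atLeast0LessThan)
qed (simp add: leading_cols_def)

text \<open>With the trailing singular values zero, the leading left singular vectors span the column space.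
Applied to the transposed decomposition it says that the leading right singular vectors span the
row space; both statements are what makes the signal invisible to residuals.\<close>

lemma svd_range_leading:
  assumes svd: "is_svd A U S W" and A: "A \<in> carrier_mat m n" and r: "r \<le> min m n"
    and S0: "\<And>k. r \<le> k \<Longrightarrow> k < min m n \<Longrightarrow> S $$ (k,k) = 0" and x: "x \<in> carrier_vec n"
  shows "\<exists>c\<in>carrier_vec r. A *\<^sub>v x = leading_cols r U *\<^sub>v c"
proof -
  note D = is_svdD[OF svd A]
  have z: "W\<^sup>T *\<^sub>v x \<in> carrier_vec n" using D(1-5) x by simp
  have "A *\<^sub>v x = leading_cols r U *\<^sub>v vec r (vec_index (S *\<^sub>v (W\<^sup>T *\<^sub>v x)))"
    unfolding svd_mult_vec[OF svd A x]
  proof (rule leading_cols_mult_vec)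
    fix i assume "r \<le> i" "i < m"
    thus "vec_index (S *\<^sub>v (W\<^sup>T *\<^sub>v x)) i = 0"
      using S0[of i] by (subst svd_diag_mult_index[OF svd A z]) auto
  qed (use D(1-5) r z in auto)
  thus ?thesis by (metis vec_carrier)
qed

lemma svd_lower_bound:
  assumes svd: "is_svd A U S W" and A: "A \<in> carrier_mat m n" and r: "q < min m n" and c: "c \<in> carrier_vec (Suc q)"
  shows "S $$ (q,q) * norm2_vec c \<le> norm2_vec (A *\<^sub>v (leading_cols (Suc q) W *\<^sub>v c))"
proof -
  note D = is_svdD[OF svd A]
  let ?c = "vec n (\<lambda>i. if i < Suc q then vec_index c i else 0)"
  let ?d = "S *\<^sub>v ?c"
  have c': "?c \<in> carrier_vec n" by simp
  have d: "?d \<in> carrier_vec m" using D(1-5) by simp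
  have "vec (Suc q) (vec_index ?c) = c" using c r by (auto intro!: eq_vecI)
  hence W: "W *\<^sub>v ?c = leading_cols (Suc q) W *\<^sub>v c"
    using leading_cols_mult_vec[of W n ?c "Suc q"] D(1-5) r by auto
  have "A *\<^sub>v (W *\<^sub>v ?c) = U *\<^sub>v ?d"
    using svd_mult_vec[OF svd A, of "W *\<^sub>v ?c"] transpose_orthonormal_cols_cancel[OF D(3,4) c'] mult_mat_vec_carrier[OF D(3) c'] by simp
  hence eq: "norm2_vec (A *\<^sub>v (W *\<^sub>v ?c)) = norm2_vec ?d"
    using norm2_orthonormal_cols[OF D(1,2) d] by simp
  have "(S $$ (q,q) * norm2_vec c)\<^sup>2 = (\<Sum>i<Suc q. (S $$ (q,q) * vec_index c i)\<^sup>2)"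
    using c by (simp add: power_mult_distrib norm2_vec_def sum_nonneg sum_distrib_left distrib_left)
  also have "\<dots> \<le> (\<Sum>i<Suc q. (vec_index ?d i)\<^sup>2)"
  proof (rule sum_mono)
    fix i assume i: "i \<in> {..<Suc q}"
    have "(S $$ (q,q) * vec_index c i)\<^sup>2 \<le> (S $$ (i,i) * vec_index c i)\<^sup>2"
      using i r D(7)[of q] D(8)[of q i] unfolding power_mult_distrib
      by (intro mult_right_mono power_mono) auto
    also have "S $$ (i,i) * vec_index c i = vec_index ?d i"
      using i r by (subst svd_diag_mult_index[OF svd A c', of i]) auto
    finally show "(S $$ (q,q) * vec_index c i)\<^sup>2 \<le> (vec_index ?d i)\<^sup>2" .
  qed
  also have "\<dots> \<le> (\<Sum>i<m. (vec_index ?d i)\<^sup>2)" by (rule sum_mono2) (use r in auto)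
  also have "\<dots> = (norm2_vec ?d)\<^sup>2" using D(1-5) by (simp add: norm2_vec_def sum_nonneg)
  finally have "S $$ (q,q) * norm2_vec c \<le> norm2_vec ?d" by (rule power2_le_imp_le) simp
  thus ?thesis using eq W by simp
qed

text \<open>Padding with zero rows gives a square matrix whose transpose kills a unit vector, hence a singular
one.\<close>

lemma underdetermined_system_solution:
  assumes A: "(A :: real mat) \<in> carrier_mat m n" and mn: "m < n"
  shows "\<exists>x\<in>carrier_vec n. x \<noteq> 0\<^sub>v n \<and> A *\<^sub>v x = 0\<^sub>v m"
proof -
  let ?B = "mat n n (\<lambda>(i,j). if i < m then A $$ (i,j) else 0)"
  have B: "?B \<in> carrier_mat n n" by simp
  have "?B\<^sup>T *\<^sub>v unit_vec n m = 0\<^sub>v n"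
    using mn by (intro eq_vecI) (auto simp: scalar_prod_right_unit)
  moreover have "unit_vec n m \<noteq> (0\<^sub>v n :: real vec)" using mn by simp
  moreover have "?B\<^sup>T \<in> carrier_mat n n" using B by (simp only: transpose_carrier_mat)
  ultimately have "det ?B\<^sup>T = 0"
    using det_0_iff_vec_prod_zero_field[of "?B\<^sup>T" n] unit_vec_carrier[of n m] by blast
  hence "det ?B = 0" unfolding det_transpose[OF B] .
  then obtain x where x: "x \<in> carrier_vec n" "x \<noteq> 0\<^sub>v n" "?B *\<^sub>v x = 0\<^sub>v n"
    using det_0_iff_vec_prod_zero_field[OF B] by blast
  have "A *\<^sub>v x = 0\<^sub>v m"
  proof (rule eq_vecI)
    fix i assume "i < dim_vec (0\<^sub>v m :: real vec)"
    hence i: "i < m" by simp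
    have "row A i = row ?B i" using A i mn by (auto intro!: eq_vecI)
    hence "vec_index (A *\<^sub>v x) i = vec_index (?B *\<^sub>v x) i" using A i mn by simp
    thus "vec_index (A *\<^sub>v x) i = vec_index (0\<^sub>v m) i" using x i mn by simp
  qed (use A in auto)
  with x show ?thesis by blast
qed

text \<open>A dimension count: the span of the first \<open>q + 1\<close> right singular vectors of \<open>X\<close> contains a nonzero
vector orthogonal to the first \<open>q\<close> right singular vectors of \<open>X + E\<close>. On that vector \<open>X\<close> stretches by
at least its own singular value and \<open>X + E\<close> by at most the perturbed one.\<close>

lemma weyl_lower:
  assumes X: "X \<in> carrier_mat m n" and E: "E \<in> carrier_mat m n"
    and svd: "is_svd X U S W" and svd': "is_svd (X + E) U' S' W'" and q: "q < min m n"
    and b: "\<And>x. x \<in> carrier_vec n \<Longrightarrow> norm2_vec (E *\<^sub>v x) \<le> b * norm2_vec x"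
  shows "S $$ (q,q) - b \<le> S' $$ (q,q)"
proof -
  have X': "X + E \<in> carrier_mat m n" using X E by simp
  note D = is_svdD[OF svd X] and D' = is_svdD[OF svd' X']
  define L where "L = leading_cols (Suc q) W"
  have L: "L \<in> carrier_mat n (Suc q)" "L\<^sup>T * L = 1\<^sub>m (Suc q)"
    using D(1-5) q by (auto simp: L_def intro!: leading_cols_carrier orthonormal_leading_cols)
  define Q where "Q = (leading_cols q W')\<^sup>T * L"
  have lW': "leading_cols q W' \<in> carrier_mat n q" by (rule leading_cols_carrier[OF D'(3)])
  have Q: "Q \<in> carrier_mat q (Suc q)" using L lW' by (simp add: Q_def)
  obtain c where c: "c \<in> carrier_vec (Suc q)" "c \<noteq> 0\<^sub>v (Suc q)" "Q *\<^sub>v c = 0\<^sub>v q"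
    using underdetermined_system_solution[OF Q] by auto
  define x where "x = L *\<^sub>v c"
  have x: "x \<in> carrier_vec n" using L c by (simp add: x_def)
  have nx: "norm2_vec x = norm2_vec c" unfolding x_def by (rule norm2_orthonormal_cols[OF L c(1)])
  have pos: "norm2_vec c > 0" using c norm2_vec_eq_0_iff[OF c(1)] norm2_vec_nonneg[of c] by linarith
  have Wx: "(leading_cols q W')\<^sup>T *\<^sub>v x = 0\<^sub>v q"
    using c(3) lW' L c(1) unfolding Q_def x_def by (subst (asm) assoc_mult_mat_vec[of _ q n _ "Suc q"]) auto
  have orth: "col W' i \<bullet> x = 0" if "i < q" for i
  proof -
    have "vec_index ((leading_cols q W')\<^sup>T *\<^sub>v x) i = col W' i \<bullet> x"
      using that lW' D'(1-5) q by (simp add: col_leading_cols)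
    thus ?thesis using Wx that by simp
  qed
  have "(X + E) *\<^sub>v x = X *\<^sub>v x + E *\<^sub>v x" by (rule add_mult_distrib_mat_vec) (use X E x in auto)
  hence "X *\<^sub>v x = (X + E) *\<^sub>v x - E *\<^sub>v x" using X E x by (auto intro!: eq_vecI)
  hence "norm2_vec (X *\<^sub>v x) \<le> norm2_vec ((X + E) *\<^sub>v x) + norm2_vec (E *\<^sub>v x)"
    using norm2_vec_minus_le[OF mult_mat_vec_carrier[OF X' x] mult_mat_vec_carrier[OF E x]] by simp
  moreover have "S $$ (q,q) * norm2_vec c \<le> norm2_vec (X *\<^sub>v x)"
    using svd_lower_bound[OF svd X q c(1)] by (simp add: x_def L_def)
  moreover have "norm2_vec ((X + E) *\<^sub>v x) \<le> S' $$ (q,q) * norm2_vec x"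
    by (rule svd_upper_bound[OF svd' X' q x orth])
  ultimately have "(S $$ (q,q) - b) * norm2_vec c \<le> S' $$ (q,q) * norm2_vec c"
    using b[OF x] nx by (simp add: algebra_simps)
  thus ?thesis using pos by simp
qed

text \<open>A left singular vector with nonzero singular value lies in the column space of \<open>A\<close>, and the columns
of \<open>U\<close> are linearly independent, so there are at most \<open>r\<close> such vectors.\<close>

lemma rank_svd:
  assumes svd: "is_svd A U S W" and A: "A \<in> carrier_mat m n" and rank: "vec_space.rank m A = r"
  shows "r \<le> min m n" "\<And>k. r \<le> k \<Longrightarrow> k < min m n \<Longrightarrow> S $$ (k,k) = 0"
proof -
  interpret vec_space "TYPE(real)" m .
  note D = is_svdD[OF svd A]
  have U_inj: "U *\<^sub>v v \<noteq> 0\<^sub>v m" if "v \<in> carrier_vec m" "v \<noteq> 0\<^sub>v m" for v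
    using that norm2_orthonormal_cols[OF D(1,2) that(1)] norm2_vec_eq_0_iff[OF that(1)] by auto
  have colsA: "set (cols A) \<subseteq> carrier_vec m" using A cols_dim by blast
  have sub: "subspace class_ring (span (set (cols A))) V" by (rule span_is_subspace[OF colsA])
  have "det U \<noteq> 0" using det_0_iff_vec_prod_zero_field[OF D(1)] U_inj by blast
  hence dist: "distinct (cols U)" using D(1)
    by (metis det_rank_iff non_distinct_low_rank less_irrefl)
  have indU: "lin_indpt (set (cols U))"
    by (rule full_rank_lin_indpt[OF D(1) _ dist]) (use det_rank_iff[OF D(1)] \<open>det U \<noteq> 0\<close> in blast)
  have dim_span: "vectorspace.dim class_ring (span_vs (set (cols A))) = r"
    using rank by (simp add: rank_def)
  have fin: "vectorspace.fin_dim class_ring (span_vs (set (cols A)))"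
    by (rule fin_dim_span_cols[OF A])
  have le: "card B \<le> r" if B: "B \<subseteq> span (set (cols A))" "lin_indpt B" for B
  proof -
    interpret sp: vectorspace class_ring "span_vs (set (cols A))" by (rule subspace_is_vs[OF sub])
    have "LinearCombinations.module.lin_dep class_ring (span_vs (set (cols A))) B \<longleftrightarrow> lin_dep B"
      by (rule span_li_not_depend(2)[OF B(1)]) (use sub in \<open>simp add: subspace_def\<close>)
    hence "sp.lin_indpt B" using B(2) by simp
    from sp.li_le_dim(2)[OF fin _ this] B(1) show ?thesis by (simp add: dim_span)
  qed
  have "r \<le> n" using rank_le_nc[OF A] rank by simp
  moreover have "r \<le> m" using subspace_dim[OF sub fin_dim fin] dim_is_n by (simp add: dim_span)
  ultimately show "r \<le> min m n" by simp
  fix k assume k: "r \<le> k" "k < min m n"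
  show "S $$ (k,k) = 0"
  proof (rule ccontr)
    assume "S $$ (k,k) \<noteq> 0"
    hence pos: "S $$ (i,i) > 0" if "i \<le> k" for i using D(7)[OF k(2)] D(8)[OF k(2) that] by linarith
    define B where "B = (\<lambda>i. col U i) ` {..k}"
    have "inj_on (col U) {..k}"
    proof (rule inj_onI)
      fix x y assume xy: "x \<in> {..k}" "y \<in> {..k}" "col U x = col U y"
      have "x < length (cols U)" "y < length (cols U)" using xy k(2) D(1) by auto
      moreover from this have "cols U ! x = cols U ! y" using xy(3) by simp
      ultimately show "x = y" using nth_eq_iff_index_eq[OF dist] by blast
    qed
    hence "card B = Suc k" by (simp add: B_def card_image)
    moreover have "B \<subseteq> set (cols U)"
      using D(1) k(2) by (auto simp: B_def cols_def)
    hence "lin_indpt B" using indU subset_li_is_li by blast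
    moreover have "B \<subseteq> span (set (cols A))"
    proof
      fix u assume "u \<in> B"
      then obtain i where i: "i \<le> k" "u = col U i" by (auto simp: B_def)
      have ci: "col W i \<in> carrier_vec n" using D(3) by auto
      have "A *\<^sub>v ((1 / S $$ (i,i)) \<cdot>\<^sub>v col W i) = (1 / S $$ (i,i)) \<cdot>\<^sub>v (A *\<^sub>v col W i)"
        by (rule mult_mat_vec[OF A ci])
      also have "\<dots> = u" using svd_right_vector[OF svd A, of i] i k pos[of i] by (simp add: smult_smult_assoc)
      finally have "A *\<^sub>v ((1 / S $$ (i,i)) \<cdot>\<^sub>v col W i) = u" .
      moreover have "u \<in> carrier_vec m" using i D(1) by auto
      ultimately show "u \<in> span (set (cols A))"
        using col_space_eq[OF A] A ci unfolding col_space_def by auto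
    qed
    ultimately have "Suc k \<le> r" using le by metis
    with k show False by simp
  qed
qed

section \<open>The two-to-infinity norm\<close>

lemma abs_mult_mat_vec_index_le:
  assumes A: "A \<in> carrier_mat n r" and x: "x \<in> carrier_vec r" and j: "j < n"
    and b: "\<And>k. k < r \<Longrightarrow> \<bar>A $$ (j,k)\<bar> \<le> b" and b0: "0 \<le> b"
  shows "\<bar>vec_index (A *\<^sub>v x) j\<bar> \<le> r * b * norm2_vec x"
proof -
  have "vec_index (A *\<^sub>v x) j = (\<Sum>k<r. A $$ (j,k) * vec_index x k)"
    using A x j by (simp add: scalar_prod_def atLeast0LessThan)
  also have "\<bar>\<dots>\<bar> \<le> (\<Sum>k<r. \<bar>A $$ (j,k)\<bar> * \<bar>vec_index x k\<bar>)"
    by (rule order.trans[OF sum_abs]) (simp add: abs_mult)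
  also have "\<dots> \<le> (\<Sum>k<r. b * norm2_vec x)"
    using b x b0 by (intro sum_mono mult_mono abs_vec_index_le_norm2_vec) auto
  finally show ?thesis by simp
qed

lemma norm_inf_vec_le_iff:
  assumes "x \<in> carrier_vec n" "0 < n"
  shows "norm_inf_vec x \<le> b \<longleftrightarrow> (\<forall>i<n. \<bar>vec_index x i\<bar> \<le> b)"
  using assms unfolding norm_inf_vec_def by (subst Max_le_iff) auto

lemma abs_index_le_two_to_inf_norm:
  assumes A: "A \<in> carrier_mat n r" and x: "x \<in> carrier_vec r" and j: "j < n"
  shows "\<bar>vec_index (A *\<^sub>v x) j\<bar> \<le> two_to_inf_norm A * norm2_vec x"
proof (cases "norm2_vec x = 0")
  case True
  hence "x = 0\<^sub>v r" using norm2_vec_eq_0_iff[OF x] by simp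
  moreover have "A *\<^sub>v 0\<^sub>v r = 0\<^sub>v n" using A by (intro eq_vecI) auto
  ultimately show ?thesis using j by simp
next
  case False
  have bdd: "bdd_above ((\<lambda>x. norm_inf_vec (A *\<^sub>v x)) ` unit_vecs (dim_col A))"
  proof (rule bdd_aboveI2)
    fix y assume "y \<in> unit_vecs (dim_col A)"
    hence y: "y \<in> carrier_vec r" "norm2_vec y = 1" using A by (auto simp: unit_vecs_def)
    have Ay: "A *\<^sub>v y \<in> carrier_vec n" using A y by simp
    have n: "0 < n" using j by simp
    show "norm_inf_vec (A *\<^sub>v y) \<le> (\<Sum>i<n. norm2_vec (row A i))"
      unfolding norm_inf_vec_le_iff[OF Ay n]
    proof (intro allI impI)
      fix i assume i: "i < n"
      have "\<bar>vec_index (A *\<^sub>v y) i\<bar> = \<bar>row A i \<bullet> y\<bar>" using A i by simp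
      also have "\<dots> \<le> norm2_vec (row A i) * norm2_vec y"
        by (rule scalar_prod_le_norm2_vec[of _ r]) (use A y in auto)
      also have "\<dots> = norm2_vec (row A i)" using y by simp
      also have "\<dots> \<le> (\<Sum>i<n. norm2_vec (row A i))"
        by (rule member_le_sum) (use i in auto)
      finally show "\<bar>vec_index (A *\<^sub>v y) i\<bar> \<le> (\<Sum>i<n. norm2_vec (row A i))" .
    qed
  qed
  \<comment> \<open>Normalise, since the supremum runs over unit vectors.\<close>
  define c where "c = norm2_vec x"
  have c: "c > 0" using False norm2_vec_nonneg[of x] unfolding c_def by linarith
  define y where "y = (1 / c) \<cdot>\<^sub>v x"
  have y: "y \<in> carrier_vec r" using x by (simp add: y_def)
  have "norm2_vec y = 1" using c by (simp add: y_def norm2_vec_smult c_def)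
  hence "y \<in> unit_vecs (dim_col A)" using A y by (simp add: unit_vecs_def)
  hence le: "norm_inf_vec (A *\<^sub>v y) \<le> two_to_inf_norm A"
    unfolding two_to_inf_norm_def by (rule cSUP_upper[OF _ bdd])
  have Ay: "A *\<^sub>v y \<in> carrier_vec n" using A y by simp
  have "\<bar>vec_index (A *\<^sub>v y) j\<bar> \<le> two_to_inf_norm A"
    using le norm_inf_vec_le_iff[OF Ay] j by (metis gr_implies_not0 not_gr0)
  moreover have "A *\<^sub>v y = (1 / c) \<cdot>\<^sub>v (A *\<^sub>v x)" unfolding y_def by (rule mult_mat_vec[OF A x])
  hence "vec_index (A *\<^sub>v y) j = vec_index (A *\<^sub>v x) j / c" using A j by simp
  ultimately show ?thesis using c by (simp add: c_def abs_mult pos_divide_le_eq)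
qed

lemma two_to_inf_norm_le_entries:
  assumes A: "A \<in> carrier_mat n r" and n: "0 < n" and r: "0 < r"
    and b: "\<And>j k. j < n \<Longrightarrow> k < r \<Longrightarrow> \<bar>A $$ (j,k)\<bar> \<le> b"
  shows "two_to_inf_norm A \<le> r * b"
  unfolding two_to_inf_norm_def
proof (rule cSUP_least)
  have "unit_vec r 0 \<in> unit_vecs (dim_col A)"
    using A r norm2_vec_unit_vec[OF r] by (simp add: unit_vecs_def)
  thus "unit_vecs (dim_col A) \<noteq> {}" by blast
  have b0: "0 \<le> b" using b[OF n r] by linarith
  fix x assume "x \<in> unit_vecs (dim_col A)"
  hence x: "x \<in> carrier_vec r" "norm2_vec x = 1" using A by (auto simp: unit_vecs_def)
  have Ax: "A *\<^sub>v x \<in> carrier_vec n" using A x by simp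
  show "norm_inf_vec (A *\<^sub>v x) \<le> r * b"
    unfolding norm_inf_vec_le_iff[OF Ax n]
    using abs_mult_mat_vec_index_le[OF A x(1) _ b b0] x(2) by simp
qed

lemma two_to_inf_norm_nonneg:
  assumes A: "A \<in> carrier_mat n r" and n: "0 < n" and r: "0 < r"
  shows "0 \<le> two_to_inf_norm A"
  using abs_index_le_two_to_inf_norm[OF A unit_vec_carrier n, of 0] norm2_vec_unit_vec[OF r]
  by (metis abs_ge_zero mult.right_neutral order.trans)

lemma norm2_le_sqrt_two_to_inf_norm:
  assumes A: "A \<in> carrier_mat n r" and x: "x \<in> carrier_vec r" "norm2_vec x = 1" and n: "0 < n" "0 < r"
  shows "norm2_vec (A *\<^sub>v x) \<le> sqrt n * two_to_inf_norm A"
proof (rule norm2_vec_le_sqrt_sum)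
  show "A *\<^sub>v x \<in> carrier_vec n" using A x by simp
  fix i assume "i < n"
  thus "\<bar>vec_index (A *\<^sub>v x) i\<bar> \<le> two_to_inf_norm A"
    using abs_index_le_two_to_inf_norm[OF A x(1)] x(2) by simp
qed (rule two_to_inf_norm_nonneg[OF A n])

section \<open>Procrustes alignment\<close>

text \<open>On a right singular vector \<open>w\<close> of \<open>V\<^sup>T * Vh\<close> the comparison of the two subspaces is a plane problem.
With $\cos\theta$ the corresponding singular value, the residual of \<open>Vh *\<^sub>v w\<close> has length $\sin\theta$, and the
Procrustes-aligned difference has length $2\sin(\theta/2)$. The first serves the upper bound, the
comparison of the two gives the lower bound.\<close>

lemma procrustes_singular_vector:
  assumes V: "V \<in> carrier_mat n r" "V\<^sup>T * V = 1\<^sub>m r" and Vh: "Vh \<in> carrier_mat n r" "Vh\<^sup>T * Vh = 1\<^sub>m r"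
    and svd: "is_svd (V\<^sup>T * Vh) W1 S W2" and k: "k < r"
  defines "w \<equiv> col W2 k"
  shows "w \<in> carrier_vec r" "norm2_vec w = 1"
    "(norm2_vec (Vh *\<^sub>v w - V *\<^sub>v (V\<^sup>T *\<^sub>v (Vh *\<^sub>v w))))\<^sup>2 = 1 - (S $$ (k,k))\<^sup>2"
    "(norm2_vec ((Vh - V * (W1 * W2\<^sup>T)) *\<^sub>v w))\<^sup>2 = 2 - 2 * S $$ (k,k)"
    "0 \<le> S $$ (k,k)" "S $$ (k,k) \<le> 1"
proof -
  have A: "V\<^sup>T * Vh \<in> carrier_mat r r" using V(1) Vh(1) by simp
  note D = is_svdD[OF svd A]
  have kk: "k < min r r" using k by simp
  define u where "u = col W1 k"
  have u: "u \<in> carrier_vec r" using D(1) by (auto simp: u_def)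
  show w: "w \<in> carrier_vec r" using D(3) by (auto simp: w_def)
  have wu: "w = W2 *\<^sub>v unit_vec r k" "u = W1 *\<^sub>v unit_vec r k"
    unfolding w_def u_def by (rule mat_unit_vec_col[symmetric]; use D(1,3) k in simp)+
  show nw: "norm2_vec w = 1"
    unfolding wu norm2_orthonormal_cols[OF D(3,4) unit_vec_carrier] by (rule norm2_vec_unit_vec[OF k])
  have nu: "norm2_vec u = 1"
    unfolding wu norm2_orthonormal_cols[OF D(1,2) unit_vec_carrier] by (rule norm2_vec_unit_vec[OF k])
  have Vhw: "Vh *\<^sub>v w \<in> carrier_vec n" using Vh(1) w by simp
  have nVhw: "norm2_vec (Vh *\<^sub>v w) = 1" using norm2_orthonormal_cols[OF Vh w] nw by simp
  have Vu: "V *\<^sub>v u \<in> carrier_vec n" using V(1) u by simp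
  have nVu: "norm2_vec (V *\<^sub>v u) = 1" using norm2_orthonormal_cols[OF V u] nu by simp
  have "(V\<^sup>T * Vh) *\<^sub>v w = V\<^sup>T *\<^sub>v (Vh *\<^sub>v w)"
    by (rule assoc_mult_mat_vec[of _ r n _ r]) (use V(1) Vh(1) w in auto)
  hence VtVhw: "V\<^sup>T *\<^sub>v (Vh *\<^sub>v w) = S $$ (k,k) \<cdot>\<^sub>v u"
    using svd_right_vector[OF svd A kk] by (simp add: w_def u_def)
  show S0: "0 \<le> S $$ (k,k)" by (rule D(7)[OF kk])
  have nV: "norm2_vec (V\<^sup>T *\<^sub>v (Vh *\<^sub>v w)) = S $$ (k,k)"
    unfolding VtVhw norm2_vec_smult nu using S0 by simp
  show "S $$ (k,k) \<le> 1"
    using norm2_transpose_orthonormal_cols_le[OF V Vhw] nV nVhw by simp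
  show "(norm2_vec (Vh *\<^sub>v w - V *\<^sub>v (V\<^sup>T *\<^sub>v (Vh *\<^sub>v w))))\<^sup>2 = 1 - (S $$ (k,k))\<^sup>2"
    unfolding norm2_residual_sq[OF V Vhw] nV nVhw by simp
  have W: "W1 * W2\<^sup>T \<in> carrier_mat r r" using D(1,3) by simp
  have "(W1 * W2\<^sup>T) *\<^sub>v w = W1 *\<^sub>v (W2\<^sup>T *\<^sub>v w)"
    by (rule assoc_mult_mat_vec[of _ r r _ r]) (use D(1,3) w in auto)
  also have "W2\<^sup>T *\<^sub>v w = unit_vec r k"
    unfolding wu by (rule transpose_orthonormal_cols_cancel[OF D(3,4) unit_vec_carrier])
  finally have Ww: "(W1 * W2\<^sup>T) *\<^sub>v w = u" by (simp add: wu)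
  have "(Vh - V * (W1 * W2\<^sup>T)) *\<^sub>v w = Vh *\<^sub>v w - (V * (W1 * W2\<^sup>T)) *\<^sub>v w"
    by (rule minus_mult_distrib_mat_vec[OF Vh(1) _ w]) (use V(1) W in auto)
  also have "(V * (W1 * W2\<^sup>T)) *\<^sub>v w = V *\<^sub>v ((W1 * W2\<^sup>T) *\<^sub>v w)"
    by (rule assoc_mult_mat_vec[OF V(1) W w])
  finally have eq: "(Vh - V * (W1 * W2\<^sup>T)) *\<^sub>v w = Vh *\<^sub>v w - V *\<^sub>v u" by (simp only: Ww)
  have uu: "u \<bullet> u = 1" using norm2_vec_sq[of u] nu by simp
  have "(Vh *\<^sub>v w) \<bullet> (V *\<^sub>v u) = (V\<^sup>T *\<^sub>v (Vh *\<^sub>v w)) \<bullet> u"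
    by (rule transpose_vec_mult_scalar[OF V(1) u Vhw, symmetric])
  also have "\<dots> = S $$ (k,k)" unfolding VtVhw using u uu by simp
  finally have ip: "(Vh *\<^sub>v w) \<bullet> (V *\<^sub>v u) = S $$ (k,k)" .
  hence ip': "(V *\<^sub>v u) \<bullet> (Vh *\<^sub>v w) = S $$ (k,k)" using comm_scalar_prod[OF Vhw Vu] by simp
  have "(Vh *\<^sub>v w) \<bullet> (Vh *\<^sub>v w) = 1" "(V *\<^sub>v u) \<bullet> (V *\<^sub>v u) = 1"
    using nVhw nVu by (simp_all flip: norm2_vec_sq)
  thus "(norm2_vec ((Vh - V * (W1 * W2\<^sup>T)) *\<^sub>v w))\<^sup>2 = 2 - 2 * S $$ (k,k)"
    unfolding eq norm2_vec_sq using Vhw Vu ip ip'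
    by (simp add: minus_scalar_prod_distrib[of _ n] scalar_prod_minus_distrib[of _ n])
qed

text \<open>The Procrustes matrix has the same singular vectors as \<open>V\<^sup>T * Vh\<close>, with all singular values replaced
by 1. The error is therefore $1 - \cos\theta \le \sin^2\theta$, which is quadratic in the distance between the
subspaces. A linear bound would be too weak for the rate.\<close>

lemma procrustes_approx:
  assumes V: "V \<in> carrier_mat n r" "V\<^sup>T * V = 1\<^sub>m r" and Vh: "Vh \<in> carrier_mat n r" "Vh\<^sup>T * Vh = 1\<^sub>m r"
    and svd: "is_svd (V\<^sup>T * Vh) W1 S W2" and x: "x \<in> carrier_vec r"
    and d: "\<And>x. x \<in> carrier_vec r \<Longrightarrow> norm2_vec (Vh *\<^sub>v x - V *\<^sub>v (V\<^sup>T *\<^sub>v (Vh *\<^sub>v x))) \<le> d * norm2_vec x"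
  shows "norm2_vec (V\<^sup>T *\<^sub>v (Vh *\<^sub>v x) - (W1 * W2\<^sup>T) *\<^sub>v x) \<le> d\<^sup>2 * norm2_vec x"
proof -
  have A: "V\<^sup>T * Vh \<in> carrier_mat r r" using V(1) Vh(1) by simp
  note D = is_svdD[OF svd A]
  define z where "z = W2\<^sup>T *\<^sub>v x"
  have z: "z \<in> carrier_vec r" using D(3) x by (simp add: z_def)
  have Sz: "S *\<^sub>v z \<in> carrier_vec r" using D(5) z by simp
  have Szz: "S *\<^sub>v z - z \<in> carrier_vec r" using Sz z by simp
  have "V\<^sup>T *\<^sub>v (Vh *\<^sub>v x) = (V\<^sup>T * Vh) *\<^sub>v x"
    by (rule assoc_mult_mat_vec[of _ r n _ r, symmetric]) (use V(1) Vh(1) x in auto)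
  also have "\<dots> = W1 *\<^sub>v (S *\<^sub>v z)" unfolding z_def by (rule svd_mult_vec[OF svd A x])
  finally have 1: "V\<^sup>T *\<^sub>v (Vh *\<^sub>v x) = W1 *\<^sub>v (S *\<^sub>v z)" .
  have 2: "(W1 * W2\<^sup>T) *\<^sub>v x = W1 *\<^sub>v z"
    unfolding z_def by (rule assoc_mult_mat_vec[of _ r r _ r]) (use D(1,3) x in auto)
  have "norm2_vec (V\<^sup>T *\<^sub>v (Vh *\<^sub>v x) - (W1 * W2\<^sup>T) *\<^sub>v x) = norm2_vec (W1 *\<^sub>v (S *\<^sub>v z - z))"
    unfolding 1 2 by (subst mult_minus_distrib_mat_vec[OF D(1) Sz z]) (rule refl)
  also have "\<dots> = norm2_vec (S *\<^sub>v z - z)" by (rule norm2_orthonormal_cols[OF D(1,2) Szz])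
  also have "\<dots> \<le> norm2_vec (d\<^sup>2 \<cdot>\<^sub>v z)"
  proof -
    have "(\<Sum>i<r. (vec_index (S *\<^sub>v z - z) i)\<^sup>2) \<le> (\<Sum>i<r. (vec_index (d\<^sup>2 \<cdot>\<^sub>v z) i)\<^sup>2)"
    proof (rule sum_mono)
      fix i assume "i \<in> {..<r}"
      hence i: "i < r" by simp
      note P = procrustes_singular_vector[OF V Vh svd i]
      have "vec_index (S *\<^sub>v z) i = S $$ (i,i) * vec_index z i"
        using i by (subst svd_diag_mult_index[OF svd A z]) auto
      hence eq: "vec_index (S *\<^sub>v z - z) i = - (1 - S $$ (i,i)) * vec_index z i"
        using i z by (simp add: algebra_simps del: index_mult_mat_vec)
      have "1 - (S $$ (i,i))\<^sup>2 \<le> d\<^sup>2"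
        using P(3) power_mono[OF d[OF P(1)] norm2_vec_nonneg, of 2] P(2) by simp
      moreover have "(S $$ (i,i))\<^sup>2 \<le> S $$ (i,i)"
        unfolding power2_eq_square by (rule mult_left_le[OF P(6,5)])
      ultimately have "1 - S $$ (i,i) \<le> d\<^sup>2" by linarith
      hence "(1 - S $$ (i,i))\<^sup>2 \<le> (d\<^sup>2)\<^sup>2" using P(6) by (intro power_mono) auto
      hence "(1 - S $$ (i,i))\<^sup>2 * (vec_index z i)\<^sup>2 \<le> (d\<^sup>2)\<^sup>2 * (vec_index z i)\<^sup>2"
        by (rule mult_right_mono) simp
      moreover have "vec_index (d\<^sup>2 \<cdot>\<^sub>v z) i = d\<^sup>2 * vec_index z i" using i z by simp
      ultimately show "(vec_index (S *\<^sub>v z - z) i)\<^sup>2 \<le> (vec_index (d\<^sup>2 \<cdot>\<^sub>v z) i)\<^sup>2"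
        unfolding eq by (simp only: power_mult_distrib power2_minus)
    qed
    thus ?thesis using Szz z by (simp add: norm2_vec_def del: index_minus_vec index_smult_vec)
  qed
  also have "\<dots> = d\<^sup>2 * norm2_vec z" by (simp add: norm2_vec_smult)
  also have "\<dots> \<le> d\<^sup>2 * norm2_vec x"
    unfolding z_def by (intro mult_left_mono norm2_transpose_orthonormal_cols_le[OF D(3,4) x]) simp
  finally show ?thesis .
qed

section \<open>The deterministic perturbation bound\<close>

lemma mat_index_eq_col_index:
  assumes "A \<in> carrier_mat n r" "j < n" "k < r"
  shows "A $$ (j,k) = vec_index (col A k) j"
  using assms by simp

text \<open>Residuals ignore the component \<open>V *\<^sub>v c\<close>. For a perturbed singular vector this component comes from
the signal, so only the noise contributes to its residual.\<close>

lemma residual_shift: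
  fixes V :: "real mat"
  assumes V: "V \<in> carrier_mat n r" "V\<^sup>T * V = 1\<^sub>m r" and c: "c \<in> carrier_vec r" and w: "w \<in> carrier_vec n"
    and v: "v \<in> carrier_vec n" and s: "s > 0" and eq: "s \<cdot>\<^sub>v v = V *\<^sub>v c + w"
  shows "v - V *\<^sub>v (V\<^sup>T *\<^sub>v v) = (1 / s) \<cdot>\<^sub>v (w - V *\<^sub>v (V\<^sup>T *\<^sub>v w))"
proof -
  have Vt: "V\<^sup>T \<in> carrier_mat r n" using V(1) by simp
  have Vc: "V *\<^sub>v c \<in> carrier_vec n" using V(1) c by simp
  have Vtw: "V\<^sup>T *\<^sub>v w \<in> carrier_vec r" using Vt w by simp
  have Vtv: "V\<^sup>T *\<^sub>v v \<in> carrier_vec r" using Vt v by simp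
  have VVw: "V *\<^sub>v (V\<^sup>T *\<^sub>v w) \<in> carrier_vec n" using V(1) Vtw by simp
  have VVv: "V *\<^sub>v (V\<^sup>T *\<^sub>v v) \<in> carrier_vec n" using V(1) Vtv by simp
  have "V\<^sup>T *\<^sub>v (s \<cdot>\<^sub>v v) = V\<^sup>T *\<^sub>v (V *\<^sub>v c) + V\<^sup>T *\<^sub>v w"
    unfolding eq by (rule mult_add_distrib_mat_vec[OF Vt Vc w])
  also have "V\<^sup>T *\<^sub>v (V *\<^sub>v c) = c" by (rule transpose_orthonormal_cols_cancel[OF V c])
  also have "V\<^sup>T *\<^sub>v (s \<cdot>\<^sub>v v) = s \<cdot>\<^sub>v (V\<^sup>T *\<^sub>v v)" by (rule mult_mat_vec[OF Vt v])
  finally have "V *\<^sub>v (s \<cdot>\<^sub>v (V\<^sup>T *\<^sub>v v)) = V *\<^sub>v (c + V\<^sup>T *\<^sub>v w)" by simp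
  also have "\<dots> = V *\<^sub>v c + V *\<^sub>v (V\<^sup>T *\<^sub>v w)" by (rule mult_add_distrib_mat_vec[OF V(1) c Vtw])
  also have "V *\<^sub>v (s \<cdot>\<^sub>v (V\<^sup>T *\<^sub>v v)) = s \<cdot>\<^sub>v (V *\<^sub>v (V\<^sup>T *\<^sub>v v))" by (rule mult_mat_vec[OF V(1) Vtv])
  finally have eq2: "s \<cdot>\<^sub>v (V *\<^sub>v (V\<^sup>T *\<^sub>v v)) = V *\<^sub>v c + V *\<^sub>v (V\<^sup>T *\<^sub>v w)" .
  show ?thesis
  proof (rule eq_vecI)
    fix i assume "i < dim_vec ((1 / s) \<cdot>\<^sub>v (w - V *\<^sub>v (V\<^sup>T *\<^sub>v w)))"
    hence i: "i < n" using V(1) by simp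
    have 1: "s * vec_index v i = vec_index (V *\<^sub>v c) i + vec_index w i"
      using arg_cong[OF eq, of "\<lambda>x. vec_index x i"] i v Vc w by (simp del: index_mult_mat_vec)
    have 2: "s * vec_index (V *\<^sub>v (V\<^sup>T *\<^sub>v v)) i = vec_index (V *\<^sub>v c) i + vec_index (V *\<^sub>v (V\<^sup>T *\<^sub>v w)) i"
      using arg_cong[OF eq2, of "\<lambda>x. vec_index x i"] i V(1) by (simp del: index_mult_mat_vec)
    have "s * (vec_index v i - vec_index (V *\<^sub>v (V\<^sup>T *\<^sub>v v)) i)
        = vec_index w i - vec_index (V *\<^sub>v (V\<^sup>T *\<^sub>v w)) i"
      unfolding right_diff_distrib 1 2 by simp
    hence "vec_index v i - vec_index (V *\<^sub>v (V\<^sup>T *\<^sub>v v)) i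
        = (vec_index w i - vec_index (V *\<^sub>v (V\<^sup>T *\<^sub>v w)) i) / s" using s by (simp add: field_simps)
    thus "vec_index (v - V *\<^sub>v (V\<^sup>T *\<^sub>v v)) i = vec_index ((1 / s) \<cdot>\<^sub>v (w - V *\<^sub>v (V\<^sup>T *\<^sub>v w))) i"
      using i v w V(1) by (simp del: index_mult_mat_vec)
  qed (use v w V(1) in simp)
qed

lemma norm2_residual_shift_le:
  assumes V: "V \<in> carrier_mat n r" "V\<^sup>T * V = 1\<^sub>m r" and c: "c \<in> carrier_vec r" and w: "w \<in> carrier_vec n"
    and v: "v \<in> carrier_vec n" and s: "0 < s" "s \<le> s'" and eq: "s' \<cdot>\<^sub>v v = V *\<^sub>v c + w"
  shows "norm2_vec (v - V *\<^sub>v (V\<^sup>T *\<^sub>v v)) \<le> norm2_vec w / s"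
proof -
  have "norm2_vec (v - V *\<^sub>v (V\<^sup>T *\<^sub>v v)) = norm2_vec (w - V *\<^sub>v (V\<^sup>T *\<^sub>v w)) / s'"
    unfolding residual_shift[OF V c w v order.strict_trans2[OF s] eq] norm2_vec_smult using s by simp
  also have "\<dots> \<le> norm2_vec w / s"
    using s norm2_residual_le[OF V w] by (intro frac_le) auto
  finally show ?thesis .
qed

text \<open>Let \<open>u\<close>, \<open>v\<close> be the \<open>k\<close>-th singular vectors of \<open>X + E\<close>, with singular value $\hat s$, and \<open>w = E\<^sup>T *\<^sub>v u\<close>.
Column \<open>k\<close> of the aligned difference equals
$$V (V^T v - W e_k) + \hat s^{-1} (w - V V^T w).$$
Terms that start with \<open>V\<close> cost only a factor \<open>two_to_inf_norm V\<close> per entry. In the remaining entry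
of \<open>w\<close>, the vector \<open>u\<close> depends on \<open>E\<close>; it is split into its projection onto the unperturbed left singular
space, where entries of \<open>E\<^sup>T *\<^sub>v col U k\<close> are small, and a residual. The residual is short, so it can be
paid for with the crude bound \<open>sqrt m * L\<close> on a column of \<open>E\<close>. Its length is controlled through
\<open>E *\<^sub>v v\<close>, where the signal part of \<open>v\<close> sees only the bound \<open>T\<close> and the full norm \<open>B\<close> meets the short
residual of \<open>v\<close>.\<close>

lemma entrywise_perturbation_bound:
  assumes X: "X \<in> carrier_mat m n" and E: "E \<in> carrier_mat m n"
    and svd: "is_svd X U S W" and svd': "is_svd (X + E) U' S' W'"
    and r: "0 < r" "r \<le> min m n"
    and S0: "\<And>k. r \<le> k \<Longrightarrow> k < min m n \<Longrightarrow> S $$ (k,k) = 0"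
  defines "V \<equiv> leading_cols r W" and "Vh \<equiv> leading_cols r W'"
  assumes proc: "is_svd (V\<^sup>T * Vh) W1 S1 W2"
    and s: "0 < s" "2 * s \<le> S $$ (r - 1, r - 1)"
    and B: "0 \<le> B" "B \<le> s" "\<And>x. x \<in> carrier_vec n \<Longrightarrow> norm2_vec (E *\<^sub>v x) \<le> B * norm2_vec x"
    and T: "0 \<le> T" "\<And>x. x \<in> carrier_vec r \<Longrightarrow> norm2_vec (E *\<^sub>v (V *\<^sub>v x)) \<le> T * norm2_vec x"
    and L: "0 \<le> L" "\<And>i j. i < m \<Longrightarrow> j < n \<Longrightarrow> \<bar>E $$ (i,j)\<bar> \<le> L"
      "\<And>k j. k < r \<Longrightarrow> j < n \<Longrightarrow> \<bar>vec_index (E\<^sup>T *\<^sub>v col U k) j\<bar> \<le> L"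
    and j: "j < n" and k: "k < r"
  shows "\<bar>(Vh - V * (W1 * W2\<^sup>T)) $$ (j,k)\<bar>
     \<le> two_to_inf_norm V * ((r * (B / s))\<^sup>2 + T / s) + (r * L + sqrt m * L * ((T + B * (B / s)) / s)) / s"
proof -
  have X': "X + E \<in> carrier_mat m n" using X E by simp
  note D = is_svdD[OF svd X] and D' = is_svdD[OF svd' X']
  have rn: "r \<le> n" "r \<le> m" and kk: "k < min m n" using r k by auto
  have V: "V \<in> carrier_mat n r" "V\<^sup>T * V = 1\<^sub>m r"
    unfolding V_def by (rule leading_cols_carrier[OF D(3)], rule orthonormal_leading_cols[OF D(3,4) rn(1)])
  have Vh: "Vh \<in> carrier_mat n r" "Vh\<^sup>T * Vh = 1\<^sub>m r"
    unfolding Vh_def by (rule leading_cols_carrier[OF D'(3)], rule orthonormal_leading_cols[OF D'(3,4) rn(1)])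
  define P where "P = leading_cols r U"
  have P: "P \<in> carrier_mat m r" "P\<^sup>T * P = 1\<^sub>m r"
    unfolding P_def by (rule leading_cols_carrier[OF D(1)], rule orthonormal_leading_cols[OF D(1,2) rn(2)])
  have Et: "E\<^sup>T \<in> carrier_mat n m" and Vt: "V\<^sup>T \<in> carrier_mat r n" using E V(1) by simp_all
  have svdT: "is_svd X\<^sup>T W S\<^sup>T U" by (rule is_svd_transpose[OF svd])
  have XT: "X\<^sup>T \<in> carrier_mat n m" using X by simp
  have S0T: "S\<^sup>T $$ (k,k) = 0" if "r \<le> k" "k < min n m" for k
    using S0[of k] that D(5) by simp
  have rT: "r \<le> min n m" using r by simp
  \<comment> \<open>Weyl's inequality keeps the leading singular values of the perturbed matrix away from zero.\<close>
  have sig: "s \<le> S' $$ (q,q)" if q: "q < r" for q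
  proof -
    have "r - 1 < min m n" using r by arith
    hence "S $$ (r - 1, r - 1) - B \<le> S' $$ (r - 1, r - 1)"
      by (rule weyl_lower[OF X E svd svd' _ B(3)])
    moreover have "S' $$ (r - 1, r - 1) \<le> S' $$ (q,q)"
      by (rule D'(8)) (use q r in auto)
    ultimately show ?thesis using s B(2) by linarith
  qed
  have ET_le: "norm2_vec (E\<^sup>T *\<^sub>v y) \<le> B * norm2_vec y" if "y \<in> carrier_vec m" for y
    by (rule norm2_transpose_mult_le[OF E B(3) that B(1)])
  have cu: "col U' q \<in> carrier_vec m" for q using D'(1) by (simp add: col_def)
  have cv: "col W' q \<in> carrier_vec n" for q using D'(3) by (simp add: col_def)
  have nu: "norm2_vec (col U' q) = 1" if "q < m" for q
    using norm2_orthonormal_cols[OF D'(1,2) unit_vec_carrier, of q] mat_unit_vec_col[OF D'(1) that] norm2_vec_unit_vec[OF that] by simp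
  have nv: "norm2_vec (col W' q) = 1" if "q < n" for q
    using norm2_orthonormal_cols[OF D'(3,4) unit_vec_carrier, of q] mat_unit_vec_col[OF D'(3) that] norm2_vec_unit_vec[OF that] by simp
  have colVh: "col Vh q = col W' q" if "q < r" for q
    unfolding Vh_def by (rule col_leading_cols[OF that]) (use D'(3) rn in simp)
  have right_eq: "\<exists>c\<in>carrier_vec r. S' $$ (q,q) \<cdot>\<^sub>v col W' q = V *\<^sub>v c + E\<^sup>T *\<^sub>v col U' q" if q: "q < r" for q
  proof -
    obtain c where c: "c \<in> carrier_vec r" "X\<^sup>T *\<^sub>v col U' q = V *\<^sub>v c"
      using svd_range_leading[OF svdT XT rT S0T cu[of q]] unfolding V_def by blast
    have "S' $$ (q,q) \<cdot>\<^sub>v col W' q = (X + E)\<^sup>T *\<^sub>v col U' q"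
      by (rule svd_left_vector[OF svd' X', symmetric]) (use q r in simp)
    also have "(X + E)\<^sup>T = X\<^sup>T + E\<^sup>T" by (rule transpose_add[OF X E])
    also have "(X\<^sup>T + E\<^sup>T) *\<^sub>v col U' q = X\<^sup>T *\<^sub>v col U' q + E\<^sup>T *\<^sub>v col U' q"
      by (rule add_mult_distrib_mat_vec[OF XT Et cu])
    finally show ?thesis using c by metis
  qed
  have ETu: "E\<^sup>T *\<^sub>v col U' q \<in> carrier_vec n" for q using Et cu[of q] by simp
  have Rv: "norm2_vec (col W' q - V *\<^sub>v (V\<^sup>T *\<^sub>v col W' q)) \<le> B / s" if q: "q < r" for q
  proof -
    obtain c where c: "c \<in> carrier_vec r" "S' $$ (q,q) \<cdot>\<^sub>v col W' q = V *\<^sub>v c + E\<^sup>T *\<^sub>v col U' q"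
      using right_eq[OF q] by blast
    have "norm2_vec (col W' q - V *\<^sub>v (V\<^sup>T *\<^sub>v col W' q)) \<le> norm2_vec (E\<^sup>T *\<^sub>v col U' q) / s"
      by (rule norm2_residual_shift_le[OF V c(1) ETu cv s(1) sig[OF q] c(2)])
    also have "norm2_vec (E\<^sup>T *\<^sub>v col U' q) \<le> B" using ET_le[OF cu, of q] nu[of q] q rn by simp
    hence "norm2_vec (E\<^sup>T *\<^sub>v col U' q) / s \<le> B / s" using s(1) by (simp add: divide_right_mono)
    finally show ?thesis .
  qed
  \<comment> \<open>The whole perturbed subspace is close to the unperturbed one.\<close>
  have sinTheta: "norm2_vec (Vh *\<^sub>v x - V *\<^sub>v (V\<^sup>T *\<^sub>v (Vh *\<^sub>v x))) \<le> (r * (B / s)) * norm2_vec x"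
    if x: "x \<in> carrier_vec r" for x
  proof -
    define G where "G = Vh - V * (V\<^sup>T * Vh)"
    have VtVh: "V\<^sup>T * Vh \<in> carrier_mat r r" using V(1) Vh(1) by simp
    have VVtVh: "V * (V\<^sup>T * Vh) \<in> carrier_mat n r" using V(1) VtVh by simp
    have G: "G \<in> carrier_mat n r" unfolding G_def by (rule minus_carrier_mat[OF VVtVh])
    have Gx: "G *\<^sub>v x = Vh *\<^sub>v x - V *\<^sub>v (V\<^sup>T *\<^sub>v (Vh *\<^sub>v x))" if x: "x \<in> carrier_vec r" for x
    proof -
      have "G *\<^sub>v x = Vh *\<^sub>v x - (V * (V\<^sup>T * Vh)) *\<^sub>v x"
        unfolding G_def by (rule minus_mult_distrib_mat_vec[OF Vh(1) VVtVh x])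
      also have "(V * (V\<^sup>T * Vh)) *\<^sub>v x = V *\<^sub>v ((V\<^sup>T * Vh) *\<^sub>v x)" by (rule assoc_mult_mat_vec[OF V(1) VtVh x])
      also have "(V\<^sup>T * Vh) *\<^sub>v x = V\<^sup>T *\<^sub>v (Vh *\<^sub>v x)" by (rule assoc_mult_mat_vec[OF Vt Vh(1) x])
      finally show ?thesis .
    qed
    have "norm2_vec (col G q) \<le> B / s" if q: "q < r" for q
    proof -
      have "col G q = G *\<^sub>v unit_vec r q" by (rule mat_unit_vec_col[OF G q, symmetric])
      also have "\<dots> = Vh *\<^sub>v unit_vec r q - V *\<^sub>v (V\<^sup>T *\<^sub>v (Vh *\<^sub>v unit_vec r q))" by (rule Gx[OF unit_vec_carrier])
      also have "Vh *\<^sub>v unit_vec r q = col W' q" unfolding mat_unit_vec_col[OF Vh(1) q] by (rule colVh[OF q])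
      finally show ?thesis using Rv[OF q] by simp
    qed
    from norm2_mult_mat_vec_le_sum_cols[OF G x this] show ?thesis unfolding Gx[OF x] by simp
  qed
  define u v w where "u = col U' k" and "v = col W' k" and "w = E\<^sup>T *\<^sub>v u"
  define a where "a = V\<^sup>T *\<^sub>v v"
  have u: "u \<in> carrier_vec m" "norm2_vec u = 1" using cu nu[of k] k rn by (auto simp: u_def)
  have v: "v \<in> carrier_vec n" "norm2_vec v = 1" using cv nv[of k] k rn by (auto simp: v_def)
  have w: "w \<in> carrier_vec n" unfolding w_def u_def by (rule ETu)
  have a: "a \<in> carrier_vec r" using Vt v(1) by (simp add: a_def)
  have Va: "V *\<^sub>v a \<in> carrier_vec n" using V(1) a by simp
  have na: "norm2_vec a \<le> 1" unfolding a_def using norm2_transpose_orthonormal_cols_le[OF V v(1)] v(2) by simp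
  define \<rho> where "\<rho> = v - V *\<^sub>v a"
  have \<rho>: "\<rho> \<in> carrier_vec n" using v(1) Va by (simp add: \<rho>_def)
  have n\<rho>: "norm2_vec \<rho> \<le> B / s" using Rv[OF k] by (simp add: \<rho>_def a_def v_def)
  have v_split: "v = V *\<^sub>v a + \<rho>"
    using v(1) V(1) by (intro eq_vecI) (auto simp: \<rho>_def simp del: index_mult_mat_vec)
  have sk: "s \<le> S' $$ (k,k)" by (rule sig[OF k])
  \<comment> \<open>The distance of \<open>u\<close> to the column space of the signal is governed by the norm of \<open>E\<close> on the
      signal directions, up to a second order term.\<close>
  have Ev: "norm2_vec (E *\<^sub>v v) \<le> T + B * (B / s)"
  proof -
    have "E *\<^sub>v v = E *\<^sub>v (V *\<^sub>v a) + E *\<^sub>v \<rho>"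
      unfolding v_split by (rule mult_add_distrib_mat_vec[OF E Va \<rho>])
    hence "norm2_vec (E *\<^sub>v v) \<le> norm2_vec (E *\<^sub>v (V *\<^sub>v a)) + norm2_vec (E *\<^sub>v \<rho>)"
      using norm2_vec_triangle[of "E *\<^sub>v (V *\<^sub>v a)" m "E *\<^sub>v \<rho>"] mult_mat_vec_carrier[OF E Va] mult_mat_vec_carrier[OF E \<rho>] by simp
    also have "norm2_vec (E *\<^sub>v (V *\<^sub>v a)) \<le> T * 1"
      by (rule order.trans[OF T(2)[OF a] mult_left_mono[OF na T(1)]])
    also have "norm2_vec (E *\<^sub>v \<rho>) \<le> B * (B / s)"
      by (rule order.trans[OF B(3)[OF \<rho>] mult_left_mono[OF n\<rho> B(1)]])
    finally show ?thesis by simp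
  qed
  define b where "b = P\<^sup>T *\<^sub>v u"
  have b: "b \<in> carrier_vec r" using P(1) u(1) by (simp add: b_def)
  have nb: "norm2_vec b \<le> 1" unfolding b_def using norm2_transpose_orthonormal_cols_le[OF P u(1)] u(2) by simp
  have Pb: "P *\<^sub>v b \<in> carrier_vec m" using P(1) b by simp
  define q where "q = u - P *\<^sub>v b"
  have q: "q \<in> carrier_vec m" using u(1) Pb by (simp add: q_def)
  have nq: "norm2_vec q \<le> (T + B * (B / s)) / s"
  proof -
    obtain c where c: "c \<in> carrier_vec r" "X *\<^sub>v v = P *\<^sub>v c"
      using svd_range_leading[OF svd X r(2) S0 v(1)] unfolding P_def by blast
    have Evc: "E *\<^sub>v v \<in> carrier_vec m" using E v(1) by simp
    have "S' $$ (k,k) \<cdot>\<^sub>v u = (X + E) *\<^sub>v v"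
      unfolding u_def v_def by (rule svd_right_vector[OF svd' X' kk, symmetric])
    also have "\<dots> = X *\<^sub>v v + E *\<^sub>v v" by (rule add_mult_distrib_mat_vec[OF X E v(1)])
    finally have eq: "S' $$ (k,k) \<cdot>\<^sub>v u = P *\<^sub>v c + E *\<^sub>v v" using c(2) by simp
    have "norm2_vec q \<le> norm2_vec (E *\<^sub>v v) / s"
      unfolding q_def b_def by (rule norm2_residual_shift_le[OF P c(1) Evc u(1) s(1) sk eq])
    also have "\<dots> \<le> (T + B * (B / s)) / s" using Ev s(1) by (simp add: divide_right_mono)
    finally show ?thesis .
  qed
  have u_split: "u = P *\<^sub>v b + q"
    using u(1) P(1) by (intro eq_vecI) (auto simp: q_def simp del: index_mult_mat_vec)
  have wj: "\<bar>vec_index w j\<bar> \<le> r * L + sqrt m * L * ((T + B * (B / s)) / s)"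
  proof -
    have EtP: "E\<^sup>T * P \<in> carrier_mat n r" using Et P(1) by simp
    have colEtP: "(E\<^sup>T * P) $$ (j,l) = vec_index (E\<^sup>T *\<^sub>v col U l) j" if l: "l < r" for l
    proof -
      have "(E\<^sup>T * P) $$ (j,l) = vec_index (col (E\<^sup>T * P) l) j"
        by (rule mat_index_eq_col_index[OF EtP j l])
      also have "col (E\<^sup>T * P) l = E\<^sup>T *\<^sub>v col P l" by (rule col_mult2[OF Et P(1) l])
      also have "col P l = col U l" unfolding P_def by (rule col_leading_cols[OF l]) (use D(1) rn in simp)
      finally show ?thesis .
    qed
    have wsum: "w = (E\<^sup>T * P) *\<^sub>v b + E\<^sup>T *\<^sub>v q"
      unfolding w_def assoc_mult_mat_vec[OF Et P(1) b]
      by (subst u_split) (rule mult_add_distrib_mat_vec[OF Et Pb q])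
    have "vec_index w j = vec_index ((E\<^sup>T * P) *\<^sub>v b) j + vec_index (E\<^sup>T *\<^sub>v q) j"
      unfolding wsum using j E by (simp del: index_mult_mat_vec)
    moreover have "\<bar>vec_index ((E\<^sup>T * P) *\<^sub>v b) j\<bar> \<le> r * L * norm2_vec b"
      by (rule abs_mult_mat_vec_index_le[OF EtP b j _ L(1)]) (simp add: colEtP L(3) j del: index_mult_mat_vec index_mult_mat)
    moreover have "r * L * norm2_vec b \<le> r * L * 1" by (intro mult_left_mono nb mult_nonneg_nonneg L(1)) simp
    moreover have "\<bar>vec_index (E\<^sup>T *\<^sub>v q) j\<bar> \<le> sqrt m * L * ((T + B * (B / s)) / s)"
    proof -
      have "vec_index (E\<^sup>T *\<^sub>v q) j = col E j \<bullet> q" using E j by simp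
      also have "\<bar>\<dots>\<bar> \<le> norm2_vec (col E j) * norm2_vec q"
        by (rule scalar_prod_le_norm2_vec[of _ m]) (use E q in auto)
      also have "\<dots> \<le> (sqrt m * L) * ((T + B * (B / s)) / s)"
      proof (rule mult_mono[OF _ nq])
        show "norm2_vec (col E j) \<le> sqrt m * L"
          by (rule norm2_vec_le_sqrt_sum[OF _ _ L(1)]) (use E j L(2) in auto)
      qed (use L(1) in auto)
      finally show ?thesis .
    qed
    ultimately show ?thesis by linarith
  qed
  define h where "h = two_to_inf_norm V"
  have h0: "0 \<le> h" unfolding h_def by (rule two_to_inf_norm_nonneg[OF V(1) _ r(1)]) (use j in simp)
  have VtW: "W1 * W2\<^sup>T \<in> carrier_mat r r"
  proof -
    have A: "V\<^sup>T * Vh \<in> carrier_mat r r" using V(1) Vh(1) by simp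
    show ?thesis using is_svdD(1,3)[OF proc A] by simp
  qed
  define y where "y = (W1 * W2\<^sup>T) *\<^sub>v unit_vec r k"
  have y: "y \<in> carrier_vec r" using VtW by (simp add: y_def)
  have Vh_e: "Vh *\<^sub>v unit_vec r k = v" unfolding mat_unit_vec_col[OF Vh(1) k] v_def by (rule colVh[OF k])
  have nay: "norm2_vec (a - y) \<le> (r * (B / s))\<^sup>2"
    using procrustes_approx[OF V Vh proc unit_vec_carrier sinTheta, of k] norm2_vec_unit_vec[OF k]
    unfolding Vh_e a_def[symmetric] y_def[symmetric] by simp
  have nVw: "norm2_vec (V\<^sup>T *\<^sub>v w) \<le> T"
  proof -
    have EV: "E * V \<in> carrier_mat m r" using E V(1) by simp
    have "V\<^sup>T *\<^sub>v w = (V\<^sup>T * E\<^sup>T) *\<^sub>v u" unfolding w_def by (rule assoc_mult_mat_vec[OF Vt Et u(1), symmetric])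
    also have "V\<^sup>T * E\<^sup>T = (E * V)\<^sup>T" by (rule transpose_mult[OF E V(1), symmetric])
    finally have "V\<^sup>T *\<^sub>v w = (E * V)\<^sup>T *\<^sub>v u" .
    moreover have "norm2_vec ((E * V)\<^sup>T *\<^sub>v u) \<le> T * norm2_vec u"
    proof (rule norm2_transpose_mult_le[OF EV _ u(1) T(1)])
      fix x :: "real vec" assume x: "x \<in> carrier_vec r"
      show "norm2_vec ((E * V) *\<^sub>v x) \<le> T * norm2_vec x"
        unfolding assoc_mult_mat_vec[OF E V(1) x] by (rule T(2)[OF x])
    qed
    ultimately show ?thesis using u(2) by simp
  qed
  have Vw: "V\<^sup>T *\<^sub>v w \<in> carrier_vec r" using Vt w by simp
  obtain c where c: "c \<in> carrier_vec r" "S' $$ (k,k) \<cdot>\<^sub>v v = V *\<^sub>v c + w"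
    using right_eq[OF k] unfolding v_def w_def u_def by blast
  have \<rho>_eq: "\<rho> = (1 / S' $$ (k,k)) \<cdot>\<^sub>v (w - V *\<^sub>v (V\<^sup>T *\<^sub>v w))"
    unfolding \<rho>_def a_def by (rule residual_shift[OF V c(1) w v(1) _ c(2)]) (use sk s(1) in linarith)
  have \<rho>j: "\<bar>vec_index \<rho> j\<bar> \<le> (\<bar>vec_index w j\<bar> + h * T) / s"
  proof -
    have VVw: "V *\<^sub>v (V\<^sup>T *\<^sub>v w) \<in> carrier_vec n" using V(1) Vw by simp
    have "vec_index \<rho> j = (vec_index w j - vec_index (V *\<^sub>v (V\<^sup>T *\<^sub>v w)) j) / S' $$ (k,k)"
      unfolding \<rho>_eq using j w V(1) by (simp del: index_mult_mat_vec)
    hence "\<bar>vec_index \<rho> j\<bar> = \<bar>vec_index w j - vec_index (V *\<^sub>v (V\<^sup>T *\<^sub>v w)) j\<bar> / S' $$ (k,k)"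
      using sk s(1) by (simp del: index_mult_mat_vec)
    also have "\<dots> \<le> (\<bar>vec_index w j\<bar> + h * T) / s"
    proof (rule frac_le)
      have "\<bar>vec_index (V *\<^sub>v (V\<^sup>T *\<^sub>v w)) j\<bar> \<le> h * norm2_vec (V\<^sup>T *\<^sub>v w)"
        unfolding h_def by (rule abs_index_le_two_to_inf_norm[OF V(1) Vw j])
      also have "\<dots> \<le> h * T" by (rule mult_left_mono[OF nVw h0])
      finally show "\<bar>vec_index w j - vec_index (V *\<^sub>v (V\<^sup>T *\<^sub>v w)) j\<bar> \<le> \<bar>vec_index w j\<bar> + h * T" by linarith
    qed (use sk s(1) h0 T(1) in auto)
    finally show ?thesis .
  qed
  have Vj: "\<bar>vec_index (V *\<^sub>v (a - y)) j\<bar> \<le> h * (r * (B / s))\<^sup>2"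
  proof -
    have "\<bar>vec_index (V *\<^sub>v (a - y)) j\<bar> \<le> h * norm2_vec (a - y)"
      unfolding h_def by (rule abs_index_le_two_to_inf_norm[OF V(1) _ j]) (use a y in simp)
    also have "\<dots> \<le> h * (r * (B / s))\<^sup>2" by (rule mult_left_mono[OF nay h0])
    finally show ?thesis .
  qed
  have VW: "V * (W1 * W2\<^sup>T) \<in> carrier_mat n r" using V(1) VtW by simp
  have M: "Vh - V * (W1 * W2\<^sup>T) \<in> carrier_mat n r" by (rule minus_carrier_mat[OF VW])
  have "(Vh - V * (W1 * W2\<^sup>T)) $$ (j,k) = vec_index (col (Vh - V * (W1 * W2\<^sup>T)) k) j"
    by (rule mat_index_eq_col_index[OF M j k])
  also have "col (Vh - V * (W1 * W2\<^sup>T)) k = (Vh - V * (W1 * W2\<^sup>T)) *\<^sub>v unit_vec r k"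
    by (rule mat_unit_vec_col[OF M k, symmetric])
  also have "\<dots> = v - (V * (W1 * W2\<^sup>T)) *\<^sub>v unit_vec r k"
    unfolding Vh_e[symmetric] by (rule minus_mult_distrib_mat_vec[OF Vh(1) VW unit_vec_carrier])
  also have "(V * (W1 * W2\<^sup>T)) *\<^sub>v unit_vec r k = V *\<^sub>v y"
    unfolding y_def by (rule assoc_mult_mat_vec[OF V(1) VtW unit_vec_carrier])
  also have "vec_index (v - V *\<^sub>v y) j = vec_index (V *\<^sub>v (a - y)) j + vec_index \<rho> j"
  proof -
    have Vy: "V *\<^sub>v y \<in> carrier_vec n" using V(1) y by simp
    have "vec_index v j = vec_index (V *\<^sub>v a) j + vec_index \<rho> j"
      using arg_cong[OF v_split, of "\<lambda>x. vec_index x j"] j V(1) \<rho> by (simp del: index_mult_mat_vec)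
    thus ?thesis unfolding mult_minus_distrib_mat_vec[OF V(1) a y]
      using j V(1) by (simp del: index_mult_mat_vec)
  qed
  finally have "\<bar>(Vh - V * (W1 * W2\<^sup>T)) $$ (j,k)\<bar> \<le> h * (r * (B / s))\<^sup>2 + (\<bar>vec_index w j\<bar> + h * T) / s"
    using Vj \<rho>j by linarith
  also have "(\<bar>vec_index w j\<bar> + h * T) / s \<le> ((r * L + sqrt m * L * ((T + B * (B / s)) / s)) + h * T) / s"
    using wj s(1) by (intro divide_right_mono) auto
  finally show ?thesis unfolding h_def[symmetric] by (simp add: algebra_simps add_divide_distrib)
qed

section \<open>Finite norming sets\<close>

lemma sum_half_powers_le:
  "(\<Sum>x\<in>{-int K..int K}. (1/2::real) ^ nat \<bar>x\<bar>) = 3 - 2 * (1/2) ^ K"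
proof (induction K)
  case (Suc K)
  have "{-int (Suc K)..int (Suc K)} = insert (-int (Suc K)) (insert (int (Suc K)) {-int K..int K})"
    by auto
  moreover have "nat (int K + 1) = Suc K" "nat \<bar>- 1 - int K\<bar> = Suc K" "nat \<bar>1 + int K\<bar> = Suc K" by auto
  ultimately have "(\<Sum>x\<in>{-int (Suc K)..int (Suc K)}. (1/2::real) ^ nat \<bar>x\<bar>)
      = (1/2) ^ Suc K + ((1/2) ^ Suc K + (\<Sum>x\<in>{-int K..int K}. (1/2) ^ nat \<bar>x\<bar>))"
    by (simp del: power_Suc)
  also have "\<dots> = 3 - 2 * (1/2) ^ Suc K" unfolding Suc.IH by simp
  finally show ?case .
qed simp

text \<open>A generating function estimate: weight the lattice point \<open>x\<close> by $2^{-|x|_1}$, which is at least $2^{-k}$ on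
the counted set, and use that the total weight of the lattice factorises over the coordinates.\<close>

lemma card_lattice_points_le:
  fixes n k :: nat
  defines "L \<equiv> {x \<in> {..<n} \<rightarrow>\<^sub>E {-int k..int k}. (\<Sum>i<n. nat \<bar>x i\<bar>) \<le> k}"
  shows "finite L" "real (card L) \<le> 3 ^ n * 2 ^ k"
proof -
  let ?P = "{..<n} \<rightarrow>\<^sub>E {-int k..int k}"
  have fP: "finite ?P" by (intro finite_PiE) auto
  show "finite L" unfolding L_def using fP by auto
  have "real (card L) = (\<Sum>x\<in>L. 1)" by simp
  also have "\<dots> \<le> (\<Sum>x\<in>L. 2 ^ k * (\<Prod>i<n. (1/2) ^ nat \<bar>x i\<bar>))"
  proof (rule sum_mono)
    fix x assume "x \<in> L"
    hence "(\<Sum>i<n. nat \<bar>x i\<bar>) \<le> k" by (auto simp: L_def)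
    hence "(1/2::real) ^ k \<le> (1/2) ^ (\<Sum>i<n. nat \<bar>x i\<bar>)" by (intro power_decreasing) auto
    also have "\<dots> = (\<Prod>i<n. (1/2) ^ nat \<bar>x i\<bar>)" by (simp add: power_sum)
    finally show "1 \<le> 2 ^ k * (\<Prod>i<n. (1/2::real) ^ nat \<bar>x i\<bar>)"
      by (simp add: power_one_over field_simps)
  qed
  also have "\<dots> \<le> (\<Sum>x\<in>?P. 2 ^ k * (\<Prod>i<n. (1/2) ^ nat \<bar>x i\<bar>))"
  proof (rule sum_mono2[OF fP])
    show "L \<subseteq> ?P" unfolding L_def by blast
  qed (intro mult_nonneg_nonneg prod_nonneg; simp)
  also have "\<dots> = 2 ^ k * (\<Prod>i<n. \<Sum>y\<in>{-int k..int k}. (1/2) ^ nat \<bar>y\<bar>)"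
    by (subst prod_sum_PiE) (simp_all only: sum_distrib_left finite_lessThan finite_atLeastAtMost_int)
  also have "\<dots> \<le> 2 ^ k * (\<Prod>i<n. 3)"
    by (intro mult_left_mono prod_mono conjI sum_nonneg) (simp_all add: sum_half_powers_le)
  finally show "real (card L) \<le> 3 ^ n * 2 ^ k" by (simp add: mult.commute)
qed

text \<open>The set consists of grid points of mesh $1/(2\sqrt n)$ in the unit ball. Rounding the direction of \<open>w\<close>
towards zero stays in the ball and moves it by at most 1/2 in norm, which costs at most half of the pairing with
\<open>w\<close>. The grid is counted with \<open>card_lattice_points_le\<close>: for integers $|x| \le x^2$, so the scaled points
have $|x|_1 \le 4 n$, and $48 = 3 \cdot 2^4$.\<close>

lemma exists_finite_norming_set:
  fixes n :: nat
  shows "\<exists>N \<subseteq> carrier_vec n. finite N \<and> real (card N) \<le> 48 ^ n \<and>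
     (\<forall>y\<in>N. norm2_vec y \<le> 1) \<and> (\<forall>w\<in>carrier_vec n. \<exists>y\<in>N. norm2_vec w \<le> 2 * (y \<bullet> w))"
proof -
  define L where "L = {x \<in> {..<n} \<rightarrow>\<^sub>E {-int (4*n)..int (4*n)}. (\<Sum>i<n. nat \<bar>x i\<bar>) \<le> 4 * n}"
  define f where "f = (\<lambda>x::nat \<Rightarrow> int. vec n (\<lambda>i. real_of_int (x i) / (2 * sqrt n)))"
  define L' where "L' = {x \<in> L. norm2_vec (f x) \<le> 1}"
  have finL: "finite L" and cardL: "real (card L) \<le> 3 ^ n * 2 ^ (4*n)"
    unfolding L_def by (rule card_lattice_points_le)+
  have "card (f ` L') \<le> card L'" using finL by (intro card_image_le) (auto simp: L'_def)
  also have "\<dots> \<le> card L" using finL by (intro card_mono) (auto simp: L'_def)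
  finally have "real (card (f ` L')) \<le> 3 ^ n * 2 ^ (4*n)" using cardL by linarith
  also have "\<dots> = (48::real) ^ n" by (simp add: power_mult flip: power_mult_distrib)
  finally have card: "real (card (f ` L')) \<le> 48 ^ n" .
  have "\<exists>y\<in>f ` L'. norm2_vec w \<le> 2 * (y \<bullet> w)" if w: "w \<in> carrier_vec n" for w
  proof -
    define s where "s = norm2_vec w"
    define u where "u i = vec_index w i / s" for i
    \<comment> \<open>\<open>x\<close> is \<open>u\<close>, scaled to mesh one and rounded towards zero.\<close>
    define m where "m i = \<lfloor>\<bar>u i\<bar> * (2 * sqrt n)\<rfloor>" for i
    define x where "x = (\<lambda>i\<in>{..<n}. if u i \<ge> 0 then m i else - m i)"
    have s0: "s \<ge> 0" by (simp add: s_def norm2_vec_def sum_nonneg)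
    have s2: "s\<^sup>2 = (\<Sum>i<n. (vec_index w i)\<^sup>2)" using w by (simp add: s_def norm2_vec_def sum_nonneg)
    have u2: "(\<Sum>i<n. (u i)\<^sup>2) \<le> 1"
      by (simp add: u_def power_divide flip: sum_divide_distrib s2)
    have m0: "m i \<ge> 0" for i by (simp add: m_def)
    have m_le: "real_of_int (m i) \<le> \<bar>u i\<bar> * (2 * sqrt n)" for i unfolding m_def by linarith
    have m_ge: "\<bar>u i\<bar> * (2 * sqrt n) \<le> real_of_int (m i) + 1" for i unfolding m_def by linarith
    have absx: "\<bar>x i\<bar> = m i" if "i < n" for i using that m0[of i] by (auto simp: x_def)
    have sqx: "(\<Sum>i<n. (real_of_int (x i))\<^sup>2) \<le> 4 * n"
    proof -
      have "(\<Sum>i<n. (real_of_int (x i))\<^sup>2) \<le> (\<Sum>i<n. (u i)\<^sup>2 * (4 * n))"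
      proof (rule sum_mono)
        fix i assume "i \<in> {..<n}"
        hence "(real_of_int (x i))\<^sup>2 = (real_of_int (m i))\<^sup>2"
          using absx[of i] by (metis lessThan_iff of_int_abs power2_abs)
        also have "\<dots> \<le> (\<bar>u i\<bar> * (2 * sqrt n))\<^sup>2" using m_le[of i] m0[of i] by (intro power_mono) auto
        finally show "(real_of_int (x i))\<^sup>2 \<le> (u i)\<^sup>2 * (4 * n)" by (simp add: power_mult_distrib)
      qed
      also have "\<dots> = (\<Sum>i<n. (u i)\<^sup>2) * (4 * real n)" by (simp add: sum_distrib_right)
      also have "\<dots> \<le> 1 * (4 * real n)" by (rule mult_right_mono[OF u2]) simp
      finally show ?thesis by simp
    qed
    have l1: "(\<Sum>i<n. nat \<bar>x i\<bar>) \<le> 4 * n"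
    proof -
      have "real (\<Sum>i<n. nat \<bar>x i\<bar>) \<le> (\<Sum>i<n. (real_of_int (x i))\<^sup>2)"
        unfolding of_nat_sum
      proof (rule sum_mono)
        fix i
        have "\<bar>x i\<bar> \<le> (x i)\<^sup>2"
          using self_le_power[of "\<bar>x i\<bar>" 2] by (cases "x i = 0") auto
        hence "real_of_int \<bar>x i\<bar> \<le> real_of_int ((x i)\<^sup>2)" by (simp only: of_int_le_iff)
        thus "real (nat \<bar>x i\<bar>) \<le> (real_of_int (x i))\<^sup>2" by simp
      qed
      with sqx show ?thesis by linarith
    qed
    have "x \<in> {..<n} \<rightarrow>\<^sub>E {-int (4*n)..int (4*n)}"
    proof (rule PiE_I)
      fix i assume i: "i \<in> {..<n}"
      have "nat \<bar>x i\<bar> \<le> (\<Sum>i<n. nat \<bar>x i\<bar>)" by (rule member_le_sum) (use i in auto)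
      with l1 show "x i \<in> {-int (4*n)..int (4*n)}" by auto
    qed (auto simp: x_def)
    with l1 have xL: "x \<in> L" by (simp add: L_def)
    have "norm2_vec (f x) \<le> 1"
    proof -
      have "(\<Sum>i<n. (real_of_int (x i) / (2 * sqrt n))\<^sup>2) = (\<Sum>i<n. (real_of_int (x i))\<^sup>2) / (4 * n)"
        by (simp add: power_divide power_mult_distrib sum_divide_distrib)
      also have "\<dots> \<le> 1" using sqx by (cases "n = 0") auto
      finally show ?thesis by (simp add: norm2_vec_def f_def)
    qed
    with xL have xL': "x \<in> L'" by (simp add: L'_def)
    have "s = (\<Sum>i<n. u i * vec_index w i)"
    proof (cases "s = 0")
      case False
      have "(\<Sum>i<n. u i * vec_index w i) = (\<Sum>i<n. (vec_index w i)\<^sup>2) / s"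
        by (simp add: u_def power2_eq_square sum_divide_distrib)
      also have "\<dots> = s" unfolding s2[symmetric] using False by (simp add: power2_eq_square)
      finally show ?thesis ..
    qed (simp add: u_def)
    also have "\<dots> \<le> (\<Sum>i<n. (real_of_int (x i) / (2 * sqrt n)) * vec_index w i + \<bar>vec_index w i\<bar> / (2 * sqrt n))"
    proof (rule sum_mono)
      fix i assume i: "i \<in> {..<n}"
      define d where "d = real_of_int (x i) / (2 * sqrt n)"
      have n0: "2 * sqrt n > 0" using i by simp
      have *: "\<bar>u i * (2 * sqrt n) - real_of_int (x i)\<bar> \<le> 1"
      proof (cases "u i \<ge> 0")
        case True
        thus ?thesis using m_le[of i] m_ge[of i] i by (simp add: x_def)
      next
        case False
        hence "\<bar>u i\<bar> * (2 * sqrt n) = - (u i * (2 * sqrt n))" by simp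
        thus ?thesis using m_le[of i] m_ge[of i] i False by (simp add: x_def)
      qed
      have "\<bar>u i - d\<bar> * (2 * sqrt n) \<le> 1"
      proof -
        have "u i * (2 * sqrt n) - real_of_int (x i) = (u i - d) * (2 * sqrt n)"
          using i by (simp add: d_def left_diff_distrib)
        with * n0 show ?thesis by (simp only: abs_mult abs_of_pos)
      qed
      hence "\<bar>u i - d\<bar> \<le> 1 / (2 * sqrt n)" using n0 by (simp add: pos_le_divide_eq)
      hence "\<bar>u i - d\<bar> * \<bar>vec_index w i\<bar> \<le> 1 / (2 * sqrt n) * \<bar>vec_index w i\<bar>"
        by (rule mult_right_mono) simp
      moreover have "(u i - d) * vec_index w i \<le> \<bar>u i - d\<bar> * \<bar>vec_index w i\<bar>" by (simp flip: abs_mult)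
      ultimately show "u i * vec_index w i \<le> d * vec_index w i + \<bar>vec_index w i\<bar> / (2 * sqrt n)"
        by (simp add: algebra_simps)
    qed
    also have "\<dots> = f x \<bullet> w + (\<Sum>i<n. \<bar>vec_index w i\<bar>) / (2 * sqrt n)"
      using w by (simp add: sum.distrib scalar_prod_def f_def atLeast0LessThan sum_divide_distrib)
    also have "(\<Sum>i<n. \<bar>vec_index w i\<bar>) \<le> sqrt n * s"
    proof -
      have "(\<Sum>i<n. \<bar>1\<bar> * \<bar>vec_index w i\<bar>) \<le> L2_set (\<lambda>_. 1) {..<n} * L2_set (vec_index w) {..<n}"
        by (rule L2_set_mult_ineq)
      also have "\<dots> = sqrt n * s" using w by (simp add: L2_set_def s_def norm2_vec_def)
      finally show ?thesis by simp
    qed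
    hence "(\<Sum>i<n. \<bar>vec_index w i\<bar>) / (2 * sqrt n) \<le> s / 2"
      using s0 by (cases "n = 0") (auto simp: field_simps)
    finally have "s \<le> 2 * (f x \<bullet> w)" by simp
    with xL' show ?thesis by (auto simp: s_def)
  qed
  moreover have "f ` L' \<subseteq> carrier_vec n" by (auto simp: f_def)
  moreover have "finite (f ` L')" using finL by (auto simp: L'_def)
  moreover have "\<forall>y\<in>f ` L'. norm2_vec y \<le> 1" by (auto simp: L'_def)
  ultimately show ?thesis using card by blast
qed

section \<open>Gaussian concentration\<close>

text \<open>Completing the square turns the integrand into a multiple of the normal density with mean \<open>c\<close>.\<close>

lemma (in prob_space) std_normal_mgf:
  assumes "distributed M lborel X std_normal_density"
  shows "(\<integral>\<^sup>+\<omega>. ennreal (exp (c * X \<omega>)) \<partial>M) = ennreal (exp (c\<^sup>2 / 2))"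
proof -
  have "(\<integral>\<^sup>+\<omega>. ennreal (exp (c * X \<omega>)) \<partial>M) = (\<integral>\<^sup>+x. ennreal (std_normal_density x) * ennreal (exp (c * x)) \<partial>lborel)"
    by (rule distributed_nn_integral[OF assms, symmetric]) auto
  also have "\<dots> = (\<integral>\<^sup>+x. ennreal (exp (c\<^sup>2 / 2)) * ennreal (normal_density c 1 x) \<partial>lborel)"
  proof (intro nn_integral_cong)
    fix x :: real
    have "exp (- x\<^sup>2 / 2) * exp (c * x) = exp (c\<^sup>2 / 2) * exp (- (x - c)\<^sup>2 / 2)"
      unfolding exp_add[symmetric] by (simp add: power2_eq_square field_simps)
    thus "ennreal (std_normal_density x) * ennreal (exp (c * x)) = ennreal (exp (c\<^sup>2 / 2)) * ennreal (normal_density c 1 x)"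
      by (simp add: normal_density_def mult_ac flip: ennreal_mult)
  qed
  also have "\<dots> = ennreal (exp (c\<^sup>2 / 2)) * (\<integral>\<^sup>+x. ennreal (normal_density c 1 x) \<partial>lborel)"
    by (rule nn_integral_cmult) simp
  also have "(\<integral>\<^sup>+x. ennreal (normal_density c 1 x) \<partial>lborel) = 1"
    by (subst nn_integral_eq_integral) auto
  finally show ?thesis by simp
qed

text \<open>Chernoff's bound with exponential parameter \<open>t\<close>, which is optimal for unit coefficient norm.\<close>

lemma (in prob_space) gaussian_linear_tail:
  fixes X :: "'i \<Rightarrow> 'a \<Rightarrow> real"
  assumes I: "finite I" and ind: "indep_vars (\<lambda>_. borel) X I"
    and N: "\<And>i. i \<in> I \<Longrightarrow> distributed M lborel (X i) std_normal_density"
    and a: "(\<Sum>i\<in>I. (a i)\<^sup>2) \<le> 1" and t: "0 < t"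
  shows "prob {\<omega>\<in>space M. t \<le> (\<Sum>i\<in>I. a i * X i \<omega>)} \<le> exp (- t\<^sup>2 / 2)"
proof -
  have meas[measurable]: "X i \<in> borel_measurable M" if "i \<in> I" for i
    using distributed_measurable[OF N[OF that]] by simp
  have Smeas[measurable]: "(\<lambda>\<omega>. \<Sum>i\<in>I. a i * X i \<omega>) \<in> borel_measurable M"
    by (intro borel_measurable_sum) auto
  have ind': "indep_vars (\<lambda>_. borel) (\<lambda>i \<omega>. ennreal (exp (t * a i * X i \<omega>))) I"
    by (rule indep_vars_compose2[OF ind]) auto
  have "(\<integral>\<^sup>+\<omega>. ennreal (exp (t * (\<Sum>i\<in>I. a i * X i \<omega>))) \<partial>M) = (\<integral>\<^sup>+\<omega>. (\<Prod>i\<in>I. ennreal (exp (t * a i * X i \<omega>))) \<partial>M)"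
    by (intro nn_integral_cong) (simp add: sum_distrib_left exp_sum I prod_ennreal mult.assoc)
  also have "\<dots> = (\<Prod>i\<in>I. \<integral>\<^sup>+\<omega>. ennreal (exp (t * a i * X i \<omega>)) \<partial>M)"
    by (rule indep_vars_nn_integral[OF I ind']) auto
  also have "\<dots> = (\<Prod>i\<in>I. ennreal (exp ((t * a i)\<^sup>2 / 2)))"
    by (intro prod.cong refl std_normal_mgf N)
  also have "\<dots> = ennreal (exp (t\<^sup>2 / 2 * (\<Sum>i\<in>I. (a i)\<^sup>2)))"
    by (simp add: prod_ennreal sum_distrib_left exp_sum I power_mult_distrib)
  also have "\<dots> \<le> ennreal (exp (t\<^sup>2 / 2 * 1))"
    by (intro ennreal_leI) (use a in \<open>simp add: mult_left_le\<close>)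
  finally have mgf: "(\<integral>\<^sup>+\<omega>. ennreal (exp (t * (\<Sum>i\<in>I. a i * X i \<omega>))) \<partial>M) \<le> ennreal (exp (t\<^sup>2 / 2))" by simp
  have "emeasure M {\<omega>\<in>space M. t \<le> (\<Sum>i\<in>I. a i * X i \<omega>)}
      \<le> ennreal (exp (- t * t)) * (\<integral>\<^sup>+\<omega>. ennreal (exp (t * (\<Sum>i\<in>I. a i * X i \<omega>))) * indicator (space M) \<omega> \<partial>M)"
    by (rule Chernoff_ineq_nn_integral_ge) (use t in auto)
  also have "(\<integral>\<^sup>+\<omega>. ennreal (exp (t * (\<Sum>i\<in>I. a i * X i \<omega>))) * indicator (space M) \<omega> \<partial>M)
      = (\<integral>\<^sup>+\<omega>. ennreal (exp (t * (\<Sum>i\<in>I. a i * X i \<omega>))) \<partial>M)"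
    by (intro nn_integral_cong) simp
  also have "ennreal (exp (- t * t)) * \<dots> \<le> ennreal (exp (- t * t)) * ennreal (exp (t\<^sup>2 / 2))"
    by (intro mult_left_mono mgf) auto
  also have "\<dots> = ennreal (exp (- t\<^sup>2 / 2))"
    by (simp flip: ennreal_mult exp_add) (simp add: power2_eq_square)
  finally show ?thesis by (simp add: emeasure_eq_measure)
qed

text \<open>Bilinear forms are linear in the entries of the matrix, with rank-one coefficients of norm
\<open>norm2_vec y * norm2_vec z\<close>; this is how the tail bound reaches them.\<close>

lemma bilinear_form_as_sum:
  fixes E :: "real mat"
  assumes "E \<in> carrier_mat m n" "y \<in> carrier_vec m" "z \<in> carrier_vec n"
  shows "y \<bullet> (E *\<^sub>v z) = (\<Sum>ij\<in>{..<m}\<times>{..<n}. (vec_index y (fst ij) * vec_index z (snd ij)) * E $$ ij)"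
proof -
  have "y \<bullet> (E *\<^sub>v z) = (\<Sum>i<m. vec_index y i * (\<Sum>j<n. E $$ (i,j) * vec_index z j))"
    using assms by (simp add: scalar_prod_def atLeast0LessThan)
  also have "\<dots> = (\<Sum>i<m. \<Sum>j<n. (vec_index y i * vec_index z j) * E $$ (i,j))"
    by (simp add: sum_distrib_left mult_ac)
  also have "\<dots> = (\<Sum>ij\<in>{..<m}\<times>{..<n}. (vec_index y (fst ij) * vec_index z (snd ij)) * E $$ ij)"
    by (simp add: sum.cartesian_product case_prod_unfold)
  finally show ?thesis .
qed

lemma (in prob_space) gaussian_bilinear_union_tail:
  assumes E: "standard_gaussian_matrix M m n E" and F: "finite F"
    and yz: "\<And>y z. (y,z) \<in> F \<Longrightarrow> y \<in> carrier_vec m \<and> z \<in> carrier_vec n \<and> norm2_vec y \<le> 1 \<and> norm2_vec z \<le> 1"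
    and t: "0 < t"
  shows "{\<omega>\<in>space M. \<exists>(y,z)\<in>F. t \<le> y \<bullet> (E \<omega> *\<^sub>v z)} \<in> events"
    "prob {\<omega>\<in>space M. \<exists>(y,z)\<in>F. t \<le> y \<bullet> (E \<omega> *\<^sub>v z)} \<le> card F * exp (- t\<^sup>2 / 2)"
proof -
  let ?I = "{..<m} \<times> {..<n}"
  have car: "\<And>\<omega>. \<omega> \<in> space M \<Longrightarrow> E \<omega> \<in> carrier_mat m n"
    and ind: "indep_vars (\<lambda>_. borel) (\<lambda>ij \<omega>. E \<omega> $$ ij) ?I"
    and N: "\<And>ij. ij \<in> ?I \<Longrightarrow> distributed M lborel (\<lambda>\<omega>. E \<omega> $$ ij) std_normal_density"
    using E unfolding standard_gaussian_matrix_def by auto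
  define Q where "Q p = {\<omega>\<in>space M. t \<le> fst p \<bullet> (E \<omega> *\<^sub>v snd p)}" for p
  have eq: "Q (y,z) = {\<omega>\<in>space M. t \<le> (\<Sum>ij\<in>?I. (vec_index y (fst ij) * vec_index z (snd ij)) * E \<omega> $$ ij)}"
    if "(y,z) \<in> F" for y z
    unfolding Q_def fst_conv snd_conv using yz[OF that] car
    by (intro Collect_cong conj_cong refl) (subst bilinear_form_as_sum, auto)
  have meas: "(\<lambda>\<omega>. E \<omega> $$ ij) \<in> borel_measurable M" if "ij \<in> ?I" for ij
    using distributed_measurable[OF N[OF that]] by simp
  have ev: "Q p \<in> events" if p: "p \<in> F" for p
  proof -
    obtain y z where yz': "p = (y,z)" by (cases p)
    have S: "(\<lambda>\<omega>. \<Sum>ij\<in>?I. (vec_index y (fst ij) * vec_index z (snd ij)) * E \<omega> $$ ij) \<in> borel_measurable M"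
      by (intro borel_measurable_sum borel_measurable_times borel_measurable_const meas)
    have "(y,z) \<in> F" using p yz' by simp
    from eq[OF this] show ?thesis unfolding yz'
      using borel_measurable_le[OF borel_measurable_const S] by (simp only:)
  qed
  have pr: "prob (Q p) \<le> exp (- t\<^sup>2 / 2)" if p: "p \<in> F" for p
  proof -
    obtain y z where yz': "p = (y,z)" by (cases p)
    have pF: "(y,z) \<in> F" using p yz' by simp
    have "(\<Sum>ij\<in>?I. (vec_index y (fst ij) * vec_index z (snd ij))\<^sup>2)
        = (\<Sum>i<m. \<Sum>j<n. (vec_index y i)\<^sup>2 * (vec_index z j)\<^sup>2)"
      by (simp add: sum.cartesian_product case_prod_unfold power_mult_distrib)
    also have "\<dots> = (\<Sum>i<m. (vec_index y i)\<^sup>2) * (\<Sum>j<n. (vec_index z j)\<^sup>2)"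
      by (simp add: sum_product)
    also have "\<dots> = (norm2_vec y)\<^sup>2 * (norm2_vec z)\<^sup>2"
    proof -
      have "dim_vec y = m" "dim_vec z = n" using yz[OF pF] by auto
      thus ?thesis by (simp add: norm2_vec_def sum_nonneg)
    qed
    also have "\<dots> \<le> 1" using yz[OF pF] by (simp add: mult_le_one power_le_one)
    finally show ?thesis unfolding yz' eq[OF pF]
      by (intro gaussian_linear_tail[OF _ ind N _ t]) auto
  qed
  have U: "{\<omega>\<in>space M. \<exists>(y,z)\<in>F. t \<le> y \<bullet> (E \<omega> *\<^sub>v z)} = (\<Union>p\<in>F. Q p)"
    unfolding Q_def by auto
  show "{\<omega>\<in>space M. \<exists>(y,z)\<in>F. t \<le> y \<bullet> (E \<omega> *\<^sub>v z)} \<in> events"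
    unfolding U using F ev by (intro sets.finite_UN) auto
  have "prob (\<Union>p\<in>F. Q p) \<le> (\<Sum>p\<in>F. prob (Q p))"
    by (rule finite_measure_subadditive_finite[OF F]) (use ev in auto)
  also have "\<dots> \<le> (\<Sum>p\<in>F. exp (- t\<^sup>2 / 2))" by (intro sum_mono pr)
  finally show "prob {\<omega>\<in>space M. \<exists>(y,z)\<in>F. t \<le> y \<bullet> (E \<omega> *\<^sub>v z)} \<le> card F * exp (- t\<^sup>2 / 2)"
    unfolding U by simp
qed

text \<open>The norming property is used once on each side, with the transpose in between; this gives the factor
\<open>2 * 2\<close>.\<close>

lemma operator_norm_via_norming_sets:
  assumes E: "E \<in> carrier_mat m n" and x: "x \<in> carrier_vec n"
    and N1: "N1 \<subseteq> carrier_vec m" "\<And>w. w \<in> carrier_vec m \<Longrightarrow> \<exists>y\<in>N1. norm2_vec w \<le> 2 * (y \<bullet> w)"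
    and N2: "N2 \<subseteq> carrier_vec n" "\<And>w. w \<in> carrier_vec n \<Longrightarrow> \<exists>z\<in>N2. norm2_vec w \<le> 2 * (z \<bullet> w)"
    and t: "\<And>y z. y \<in> N1 \<Longrightarrow> z \<in> N2 \<Longrightarrow> y \<bullet> (E *\<^sub>v z) \<le> t"
  shows "norm2_vec (E *\<^sub>v x) \<le> 4 * t * norm2_vec x"
proof -
  have Ex: "E *\<^sub>v x \<in> carrier_vec m" using E x by simp
  obtain y where y: "y \<in> N1" "norm2_vec (E *\<^sub>v x) \<le> 2 * (y \<bullet> (E *\<^sub>v x))" using N1(2)[OF Ex] by blast
  have yc: "y \<in> carrier_vec m" using y N1(1) by blast
  let ?w = "E\<^sup>T *\<^sub>v y"
  have w: "?w \<in> carrier_vec n" using E yc by simp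
  obtain z where z: "z \<in> N2" "norm2_vec ?w \<le> 2 * (z \<bullet> ?w)" using N2(2)[OF w] by blast
  have zc: "z \<in> carrier_vec n" using z N2(1) by blast
  have "z \<bullet> ?w = ?w \<bullet> z" by (rule comm_scalar_prod[OF zc w])
  also have "\<dots> = y \<bullet> (E *\<^sub>v z)" by (rule transpose_vec_mult_scalar[OF E zc yc])
  also have "\<dots> \<le> t" by (rule t[OF y(1) z(1)])
  finally have nw: "norm2_vec ?w \<le> 2 * t" using z(2) by linarith
  have "y \<bullet> (E *\<^sub>v x) = ?w \<bullet> x" by (rule transpose_vec_mult_scalar[OF E x yc, symmetric])
  also have "\<dots> \<le> norm2_vec ?w * norm2_vec x" using scalar_prod_le_norm2_vec[OF w x] by linarith
  also have "\<dots> \<le> 2 * t * norm2_vec x" by (rule mult_right_mono[OF nw norm2_vec_nonneg])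
  finally show ?thesis using y(2) by linarith
qed

lemma exp_minus_le_inverse: "0 < x \<Longrightarrow> exp (- x) \<le> 1 / (x::real)"
proof -
  assume x: "0 < x"
  have "exp (- x) = 1 / exp x" by (simp add: exp_minus inverse_eq_divide)
  also have "\<dots> \<le> 1 / x" using x exp_ge_add_one_self[of x] by (intro frac_le) linarith+
  finally show ?thesis .
qed

lemma power48_le_exp: "(48::real) ^ k \<le> exp (6 * real k)"
proof -
  have "(2::real) \<le> exp 1" using exp_ge_add_one_self[of 1] by simp
  hence "(2::real) ^ 6 \<le> exp 1 ^ 6" by (rule power_mono) simp
  hence "(48::real) \<le> exp 6" by (simp flip: exp_of_nat_mult)
  hence "(48::real) ^ k \<le> exp 6 ^ k" by (rule power_mono) simp
  thus ?thesis by (simp add: mult.commute flip: exp_of_nat_mult)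
qed

text \<open>The thresholds \<open>5 * sqrt n\<close> and \<open>4 * sqrt m\<close> are chosen so that the Gaussian exponents $25n/2$ and $8m$
beat the entropies $6(m+n) \le 12 n$ and $6m$ of the norming sets; the threshold \<open>3 * ln n\<close> beats a polynomial
number of events.\<close>

lemma noise_failure_probability_le:
  fixes m n r :: nat
  assumes mn: "1 \<le> m" "m \<le> n" "r \<le> m" and ln: "1 \<le> ln (real n)"
  shows "48 ^ m * 48 ^ n * exp (- (5 * sqrt n)\<^sup>2 / 2) \<le> 2 / real m"
    "48 ^ m * real r * exp (- (4 * sqrt m)\<^sup>2 / 2) \<le> real r / real m"
    "2 * (real m + real r) * real n * exp (- (3 * ln n)\<^sup>2 / 2) \<le> 4 / real m"
proof -
  have m0: "real m > 0" and n0: "real n > 0" using mn by auto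
  have "48 ^ m * 48 ^ n * exp (- (5 * sqrt n)\<^sup>2 / 2)
      \<le> exp (6 * real m) * exp (6 * real n) * exp (- (5 * sqrt n)\<^sup>2 / 2)"
    by (intro mult_mono power48_le_exp) auto
  also have "\<dots> = exp (6 * real m - 13 / 2 * real n)"
    by (simp add: power_mult_distrib flip: exp_add)
  also have "\<dots> \<le> exp (- (real m / 2))" using mn by simp
  also have "\<dots> \<le> 1 / (real m / 2)" by (rule exp_minus_le_inverse) (use m0 in simp)
  finally show "48 ^ m * 48 ^ n * exp (- (5 * sqrt n)\<^sup>2 / 2) \<le> 2 / real m" by simp
  have "48 ^ m * exp (- (4 * sqrt m)\<^sup>2 / 2) \<le> exp (6 * real m) * exp (- (4 * sqrt m)\<^sup>2 / 2)"
    by (intro mult_right_mono power48_le_exp) auto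
  also have "\<dots> = exp (- (2 * real m))" by (simp add: power_mult_distrib flip: exp_add)
  also have "\<dots> \<le> exp (- real m)" using m0 by simp
  also have "\<dots> \<le> 1 / real m" by (rule exp_minus_le_inverse[OF m0])
  finally have "real r * (48 ^ m * exp (- (4 * sqrt m)\<^sup>2 / 2)) \<le> real r * (1 / real m)"
    by (rule mult_left_mono) simp
  thus "48 ^ m * real r * exp (- (4 * sqrt m)\<^sup>2 / 2) \<le> real r / real m" by (simp add: mult_ac)
  have "ln n * 3 \<le> (3 * ln n)\<^sup>2 / 2"
    using mult_left_mono[OF ln, of "ln n"] ln by (simp add: power2_eq_square)
  hence "exp (- (3 * ln n)\<^sup>2 / 2) \<le> exp (- (ln n * 3))" by simp
  also have "\<dots> = inverse (exp (ln n) ^ 3)" by (simp add: exp_minus mult.commute flip: exp_of_nat_mult)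
  also have "\<dots> = 1 / real n ^ 3" using n0 by (simp add: inverse_eq_divide)
  finally have e: "exp (- (3 * ln n)\<^sup>2 / 2) \<le> 1 / real n ^ 3" .
  have "2 * (real m + real r) * real n * exp (- (3 * ln n)\<^sup>2 / 2) \<le> 2 * (real n + real n) * real n * (1 / real n ^ 3)"
    using mn e by (intro mult_mono) auto
  also have "\<dots> = 4 / real n" using n0 by (simp add: field_simps power3_eq_cube)
  also have "\<dots> \<le> 4 / real m" using mn m0 by (simp add: frac_le)
  finally show "2 * (real m + real r) * real n * exp (- (3 * ln n)\<^sup>2 / 2) \<le> 4 / real m" .
qed

lemma norm2_col_orthonormal:
  assumes "Q \<in> carrier_mat n r" "Q\<^sup>T * Q = 1\<^sub>m r" "k < r"
  shows "norm2_vec (col Q k) = 1"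
  using norm2_orthonormal_cols[OF assms(1,2) unit_vec_carrier, of k] mat_unit_vec_col[OF assms(1,3)]
    norm2_vec_unit_vec[OF assms(3)] by simp

text \<open>All four bounds are maxima of bilinear forms of \<open>E\<close> over finite deterministic sets, up to the
discretisation by norming sets. On the signal directions \<open>V\<close> only the left vector has to be
discretised, which improves $\sqrt n$ to $\sqrt m$.\<close>

lemma (in prob_space) gaussian_noise_event:
  assumes E: "standard_gaussian_matrix M m n E"
    and mn: "1 \<le> m" "m \<le> n" "r \<le> m" and ln: "1 \<le> ln (real n)"
    and V: "V \<in> carrier_mat n r" "V\<^sup>T * V = 1\<^sub>m r"
    and U: "U \<in> carrier_mat m m" "U\<^sup>T * U = 1\<^sub>m m"
  shows "\<exists>A\<in>events. 1 - (real r + 6) / real m \<le> prob A \<and> A \<subseteq> space M \<and> (\<forall>\<omega>\<in>A.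
     (\<forall>x\<in>carrier_vec n. norm2_vec (E \<omega> *\<^sub>v x) \<le> 20 * sqrt n * norm2_vec x) \<and>
     (\<forall>x\<in>carrier_vec r. norm2_vec (E \<omega> *\<^sub>v (V *\<^sub>v x)) \<le> r * (8 * sqrt m) * norm2_vec x) \<and>
     (\<forall>i<m. \<forall>j<n. \<bar>E \<omega> $$ (i,j)\<bar> \<le> 3 * ln n) \<and>
     (\<forall>k<r. \<forall>j<n. \<bar>vec_index ((E \<omega>)\<^sup>T *\<^sub>v col U k) j\<bar> \<le> 3 * ln n))"
proof -
  obtain N1 where N1: "N1 \<subseteq> carrier_vec m" "finite N1" "real (card N1) \<le> 48 ^ m"
    "\<And>y. y \<in> N1 \<Longrightarrow> norm2_vec y \<le> 1" "\<And>w. w \<in> carrier_vec m \<Longrightarrow> \<exists>y\<in>N1. norm2_vec w \<le> 2 * (y \<bullet> w)"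
    using exists_finite_norming_set[of m] by blast
  obtain N2 where N2: "N2 \<subseteq> carrier_vec n" "finite N2" "real (card N2) \<le> 48 ^ n"
    "\<And>y. y \<in> N2 \<Longrightarrow> norm2_vec y \<le> 1" "\<And>w. w \<in> carrier_vec n \<Longrightarrow> \<exists>y\<in>N2. norm2_vec w \<le> 2 * (y \<bullet> w)"
    using exists_finite_norming_set[of n] by blast
  have car: "E \<omega> \<in> carrier_mat m n" if "\<omega> \<in> space M" for \<omega>
    using E that unfolding standard_gaussian_matrix_def by auto
  define K where "K = unit_vec m ` {..<m} \<union> col U ` {..<r}"
  have K: "y \<in> carrier_vec m" "norm2_vec y \<le> 1" if "y \<in> K" for y
    using that norm2_vec_unit_vec[of _ m] norm2_col_orthonormal[OF U] U(1) mn(3) by (auto simp: K_def)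
  have cardK: "card K \<le> m + r"
    unfolding K_def by (rule order.trans[OF card_Un_le add_mono]) (use card_image_le[of "{..<m}"] card_image_le[of "{..<r}"] in auto)
  have finK: "finite K" by (simp add: K_def)
  \<comment> \<open>\<open>F1\<close> controls the operator norm and \<open>F2\<close> the action on the columns of \<open>V\<close>. \<open>F3\<close> controls absolute values,
      hence both signs, of the entries of \<open>E\<close> (from the unit vectors in \<open>K\<close>) and of \<open>E\<^sup>T *\<^sub>v col U k\<close>.\<close>
  define F1 where "F1 = N1 \<times> N2"
  define F2 where "F2 = N1 \<times> col V ` {..<r}"
  define F3 where "F3 = (K \<union> uminus ` K) \<times> (unit_vec n ` {..<n} :: real vec set)"
  define Bad where "Bad F t = {\<omega>\<in>space M. \<exists>(y,z)\<in>F. t \<le> y \<bullet> (E \<omega> *\<^sub>v z)}" for F t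
  have fin: "finite F1" "finite F2" "finite F3"
    using N1(2) N2(2) finK by (auto simp: F1_def F2_def F3_def)
  have F1: "y \<in> carrier_vec m \<and> z \<in> carrier_vec n \<and> norm2_vec y \<le> 1 \<and> norm2_vec z \<le> 1" if "(y,z) \<in> F1" for y z
    using that N1(1,4) N2(1,4) by (auto simp: F1_def)
  have F2: "y \<in> carrier_vec m \<and> z \<in> carrier_vec n \<and> norm2_vec y \<le> 1 \<and> norm2_vec z \<le> 1" if "(y,z) \<in> F2" for y z
    using that N1(1,4) norm2_col_orthonormal[OF V] V(1) by (auto simp: F2_def)
  have F3: "y \<in> carrier_vec m \<and> z \<in> carrier_vec n \<and> norm2_vec y \<le> 1 \<and> norm2_vec z \<le> 1" if "(y,z) \<in> F3" for y z
    using that K norm2_vec_unit_vec[of _ n] by (auto simp: F3_def norm2_vec_uminus)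
  have t: "0 < 5 * sqrt n" "0 < 4 * sqrt m" "0 < 3 * ln n" using mn ln by (simp, simp, linarith)
  note T1 = gaussian_bilinear_union_tail[OF E fin(1) F1 t(1), folded Bad_def]
    and T2 = gaussian_bilinear_union_tail[OF E fin(2) F2 t(2), folded Bad_def]
    and T3 = gaussian_bilinear_union_tail[OF E fin(3) F3 t(3), folded Bad_def]
  note P = noise_failure_probability_le[OF mn ln]
  have "real (card F1) \<le> 48 ^ m * 48 ^ n"
    unfolding F1_def card_cartesian_product of_nat_mult by (intro mult_mono N1(3) N2(3)) auto
  hence "real (card F1) * exp (- (5 * sqrt n)\<^sup>2 / 2) \<le> 48 ^ m * 48 ^ n * exp (- (5 * sqrt n)\<^sup>2 / 2)"
    by (rule mult_right_mono) simp
  with T1(2) P(1) have p1: "prob (Bad F1 (5 * sqrt n)) \<le> 2 / m" by linarith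
  have "card (col V ` {..<r}) \<le> r" using card_image_le[of "{..<r}" "col V"] by simp
  hence "real (card F2) \<le> 48 ^ m * real r"
    unfolding F2_def card_cartesian_product of_nat_mult by (intro mult_mono N1(3)) auto
  hence "real (card F2) * exp (- (4 * sqrt m)\<^sup>2 / 2) \<le> 48 ^ m * real r * exp (- (4 * sqrt m)\<^sup>2 / 2)"
    by (rule mult_right_mono) simp
  with T2(2) P(2) have p2: "prob (Bad F2 (4 * sqrt m)) \<le> r / m" by linarith
  have "card (K \<union> uminus ` K) \<le> card K + card (uminus ` K)" by (rule card_Un_le)
  moreover have "card (uminus ` K) \<le> card K" by (rule card_image_le[OF finK])
  ultimately have "card (K \<union> uminus ` K) \<le> 2 * (m + r)" using cardK by simp
  moreover have "card (unit_vec n ` {..<n} :: real vec set) \<le> n" using card_image_le[of "{..<n}" "unit_vec n"] by simp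
  ultimately have "card F3 \<le> 2 * (m + r) * n"
    unfolding F3_def card_cartesian_product by (intro mult_le_mono)
  hence "real (card F3) \<le> real (2 * (m + r) * n)" by (simp only: of_nat_le_iff)
  hence "real (card F3) \<le> 2 * (real m + real r) * real n" by simp
  hence "real (card F3) * exp (- (3 * ln n)\<^sup>2 / 2) \<le> 2 * (real m + real r) * real n * exp (- (3 * ln n)\<^sup>2 / 2)"
    by (rule mult_right_mono) simp
  with T3(2) P(3) have p3: "prob (Bad F3 (3 * ln n)) \<le> 4 / m" by linarith
  define Z where "Z = Bad F1 (5 * sqrt n) \<union> Bad F2 (4 * sqrt m) \<union> Bad F3 (3 * ln n)"
  have Zev: "Z \<in> events" unfolding Z_def using T1(1) T2(1) T3(1) by (intro sets.Un)
  have "prob Z \<le> prob (Bad F1 (5 * sqrt n)) + prob (Bad F2 (4 * sqrt m)) + prob (Bad F3 (3 * ln n))"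
    unfolding Z_def
    by (rule order.trans[OF measure_Un_le add_right_mono[OF measure_Un_le]])
       (use T1(1) T2(1) T3(1) in auto)
  also have "\<dots> \<le> 2 / m + r / m + 4 / m" using p1 p2 p3 by (intro add_mono)
  also have "\<dots> = (real r + 6) / m" by (simp add: add_divide_distrib)
  finally have pZ: "prob Z \<le> (real r + 6) / m" .
  have "prob (space M - Z) = 1 - prob Z" by (rule prob_compl[OF Zev])
  with pZ have pA: "1 - (real r + 6) / real m \<le> prob (space M - Z)" by linarith
  have good: "y \<bullet> (E \<omega> *\<^sub>v z) \<le> t" if "\<omega> \<in> space M - Bad F t" "(y,z) \<in> F" for \<omega> F t y z
    using that unfolding Bad_def by force
  show ?thesis
  proof (intro bexI[of _ "space M - Z"] conjI ballI allI impI)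
    show "space M - Z \<in> events" using Zev by blast
    show "1 - (real r + 6) / real m \<le> prob (space M - Z)" by (rule pA)
    show "space M - Z \<subseteq> space M" by blast
    fix \<omega> assume \<omega>: "\<omega> \<in> space M - Z"
    hence \<omega>1: "\<omega> \<in> space M - Bad F1 (5 * sqrt n)" and \<omega>2: "\<omega> \<in> space M - Bad F2 (4 * sqrt m)"
      and \<omega>3: "\<omega> \<in> space M - Bad F3 (3 * ln n)" by (auto simp: Z_def)
    have Ec: "E \<omega> \<in> carrier_mat m n" using car \<omega> by blast
    have EV: "E \<omega> * V \<in> carrier_mat m r" using Ec V(1) by simp
    show "norm2_vec (E \<omega> *\<^sub>v x) \<le> 20 * sqrt n * norm2_vec x" if x: "x \<in> carrier_vec n" for x
    proof -
      have "norm2_vec (E \<omega> *\<^sub>v x) \<le> 4 * (5 * sqrt n) * norm2_vec x"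
        by (rule operator_norm_via_norming_sets[OF Ec x N1(1,5) N2(1,5) good[OF \<omega>1]]) (auto simp: F1_def)
      thus ?thesis by simp
    qed
    show "norm2_vec (E \<omega> *\<^sub>v (V *\<^sub>v x)) \<le> r * (8 * sqrt m) * norm2_vec x" if x: "x \<in> carrier_vec r" for x
    proof -
      have "norm2_vec (col (E \<omega> * V) k) \<le> 8 * sqrt m" if k: "k < r" for k
      proof -
        have col: "col (E \<omega> * V) k = E \<omega> *\<^sub>v col V k" by (rule col_mult2[OF Ec V(1) k])
        have "E \<omega> *\<^sub>v col V k \<in> carrier_vec m" using EV k unfolding col[symmetric] by (auto simp: col_def)
        from N1(5)[OF this] obtain y where y: "y \<in> N1" "norm2_vec (E \<omega> *\<^sub>v col V k) \<le> 2 * (y \<bullet> (E \<omega> *\<^sub>v col V k))"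
          by blast
        have "(y, col V k) \<in> F2" using y k by (auto simp: F2_def)
        from good[OF \<omega>2 this] y(2) show ?thesis unfolding col by linarith
      qed
      from norm2_mult_mat_vec_le_sum_cols[OF EV x this] show ?thesis
        unfolding assoc_mult_mat_vec[OF Ec V(1) x] .
    qed
    have key: "\<bar>y \<bullet> col (E \<omega>) j\<bar> \<le> 3 * ln n" if y: "y \<in> K" and j: "j < n" for y j
    proof -
      have c: "E \<omega> *\<^sub>v unit_vec n j = col (E \<omega>) j" by (rule mat_unit_vec_col[OF Ec j])
      have "y \<bullet> col (E \<omega>) j \<le> 3 * ln n" unfolding c[symmetric]
        by (rule good[OF \<omega>3]) (use y j in \<open>auto simp: F3_def\<close>)
      moreover have "(- y) \<bullet> col (E \<omega>) j \<le> 3 * ln n" unfolding c[symmetric]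
        by (rule good[OF \<omega>3]) (use y j in \<open>auto simp: F3_def\<close>)
      moreover have "(- y) \<bullet> col (E \<omega>) j = - (y \<bullet> col (E \<omega>) j)"
        by (rule scalar_prod_uminus_left) (use K(1)[OF y] Ec in auto)
      ultimately show ?thesis by linarith
    qed
    show "\<bar>E \<omega> $$ (i,j)\<bar> \<le> 3 * ln n" if i: "i < m" and j: "j < n" for i j
    proof -
      have "col (E \<omega>) j \<in> carrier_vec m" using Ec by (auto simp: col_def)
      hence "unit_vec m i \<bullet> col (E \<omega>) j = E \<omega> $$ (i,j)" using scalar_prod_left_unit[OF _ i] Ec i j by simp
      moreover have "unit_vec m i \<in> K" using i by (auto simp: K_def)
      ultimately show ?thesis using key[OF _ j] by metis
    qed
    show "\<bar>vec_index ((E \<omega>)\<^sup>T *\<^sub>v col U k) j\<bar> \<le> 3 * ln n" if k: "k < r" and j: "j < n" for k j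
    proof -
      have cU: "col U k \<in> carrier_vec m" using U(1) by (auto simp: col_def)
      have cE: "col (E \<omega>) j \<in> carrier_vec m" using Ec by (auto simp: col_def)
      have "vec_index ((E \<omega>)\<^sup>T *\<^sub>v col U k) j = col (E \<omega>) j \<bullet> col U k" using Ec j by simp
      also have "\<dots> = col U k \<bullet> col (E \<omega>) j" by (rule comm_scalar_prod[OF cE cU])
      finally show ?thesis using key[OF _ j, of "col U k"] k by (simp add: K_def)
    qed
  qed
qed

section \<open>Upper bound with high probability\<close>

text \<open>An explicit constant for the entrywise bound. The summands account, in this order, for the Procrustes
error, for $V V^T E^T u$, for the projection of \<open>u\<close> onto the left singular space of the signal, and for
the residual of \<open>u\<close>.\<close>

definition rate_const :: "nat \<Rightarrow> real \<Rightarrow> real" where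
  "rate_const r C = 1600 * (real r)\<^sup>2 / C + 16 * r + 6 * r + 12 * (8 * r + 800 / C)"

lemma rate_const_pos: "0 < r \<Longrightarrow> 0 < C \<Longrightarrow> 0 < rate_const r C"
  unfolding rate_const_def by (intro add_pos_pos mult_pos_pos divide_pos_pos) auto

text \<open>The right-hand side of \<open>entrywise_perturbation_bound\<close> with the noise levels of
\<open>gaussian_noise_event\<close> inserted. The signal strength enters as $n / \sigma \le \sqrt m / C$: it reduces the second
order quantities $B^2 / s$ to the size $\sqrt m$ of the first order ones.\<close>

lemma rate_arithmetic:
  fixes h C \<sigma> s B T L :: real and m n r :: nat
  assumes C: "0 < C" and \<sigma>: "0 < \<sigma>" and h: "0 \<le> h" and ln: "1 \<le> ln (real n)" and m: "1 \<le> m"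
    and signal: "C * (real n / sqrt m) \<le> \<sigma>"
  defines "s \<equiv> \<sigma> / 2" and "B \<equiv> 20 * sqrt n" and "T \<equiv> r * (8 * sqrt m)" and "L \<equiv> 3 * ln n"
  shows "h * ((r * (B / s))\<^sup>2 + T / s) + (r * L + sqrt m * L * ((T + B * (B / s)) / s)) / s
    \<le> rate_const r C * (ln n / \<sigma>) * (1 + m / \<sigma> + sqrt m / ln n * h)"
proof -
  define K where "K = 8 * r + 800 / C"
  have K0: "0 \<le> K" using C by (simp add: K_def)
  have ln0: "0 < ln (real n)" using ln by linarith
  have m0: "0 < sqrt m" using m by simp
  have n\<sigma>: "n / \<sigma> \<le> sqrt m / C"
    using signal C \<sigma> m0 by (simp add: field_simps)
  have "(r * (B / s))\<^sup>2 = 1600 * (real r)\<^sup>2 * (n / \<sigma>) / \<sigma>"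
    by (simp add: B_def s_def power_mult_distrib power_divide) (simp add: power2_eq_square)
  also have "\<dots> \<le> 1600 * (real r)\<^sup>2 * (sqrt m / C) / \<sigma>"
    using n\<sigma> \<sigma> by (intro divide_right_mono mult_left_mono) auto
  also have "\<dots> = 1600 * (real r)\<^sup>2 / C * (sqrt m / \<sigma>)" by simp
  finally have "(r * (B / s))\<^sup>2 \<le> 1600 * (real r)\<^sup>2 / C * (sqrt m / \<sigma>)" .
  moreover have "T / s = 16 * r * (sqrt m / \<sigma>)" by (simp add: T_def s_def)
  ultimately have 1: "(r * (B / s))\<^sup>2 + T / s \<le> (1600 * (real r)\<^sup>2 / C + 16 * r) * (sqrt m / \<sigma>)"
    unfolding distrib_right by linarith
  have "h * ((r * (B / s))\<^sup>2 + T / s) \<le> h * ((1600 * (real r)\<^sup>2 / C + 16 * r) * (sqrt m / \<sigma>))"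
    by (rule mult_left_mono[OF 1 h])
  also have "\<dots> = (1600 * (real r)\<^sup>2 / C + 16 * r) * ((ln n / \<sigma>) * (sqrt m / ln n * h))"
    using ln0 by simp
  finally have A: "h * ((r * (B / s))\<^sup>2 + T / s) \<le> (1600 * (real r)\<^sup>2 / C + 16 * r) * ((ln n / \<sigma>) * (sqrt m / ln n * h))" .
  have "B * (B / s) = 800 * (n / \<sigma>)" by (simp add: B_def s_def)
  also have "\<dots> \<le> 800 * (sqrt m / C)" using n\<sigma> by (intro mult_left_mono) auto
  finally have "T + B * (B / s) \<le> sqrt m * K" by (simp add: T_def K_def algebra_simps)
  hence "(T + B * (B / s)) / s \<le> sqrt m * K / s" using \<sigma> by (intro divide_right_mono) (auto simp: s_def)
  hence "sqrt m * L * ((T + B * (B / s)) / s) \<le> sqrt m * L * (sqrt m * K / s)"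
    using ln0 by (intro mult_left_mono) (auto simp: L_def intro!: mult_nonneg_nonneg)
  also have "\<dots> = 6 * K * ln n * m / \<sigma>" by (simp add: L_def s_def)
  finally have "(r * L + sqrt m * L * ((T + B * (B / s)) / s)) / s \<le> (r * L + 6 * K * ln n * m / \<sigma>) / s"
    using \<sigma> by (intro divide_right_mono add_left_mono) (auto simp: s_def)
  also have "\<dots> = (6 * r) * (ln n / \<sigma> * 1) + 12 * K * (ln n / \<sigma> * (m / \<sigma>))"
    using \<sigma> by (simp add: L_def s_def field_simps)
  finally have B': "(r * L + sqrt m * L * ((T + B * (B / s)) / s)) / s
     \<le> (6 * r) * (ln n / \<sigma> * 1) + 12 * K * (ln n / \<sigma> * (m / \<sigma>))" .
  have combine: "a1 * x1 + (a2 * x2 + a3 * x3) \<le> (a1 + a2 + a3) * (x2 + x3 + x1)"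
    if "0 \<le> a1" "0 \<le> a2" "0 \<le> a3" "0 \<le> x1" "0 \<le> x2" "0 \<le> x3" for a1 a2 a3 x1 x2 x3 :: real
  proof -
    have "0 \<le> a1 * x2 + a1 * x3 + (a2 * x1 + a2 * x3) + (a3 * x1 + a3 * x2)"
      using that by (intro add_nonneg_nonneg mult_nonneg_nonneg)
    thus ?thesis by (simp add: algebra_simps)
  qed
  have "h * ((r * (B / s))\<^sup>2 + T / s) + (r * L + sqrt m * L * ((T + B * (B / s)) / s)) / s
     \<le> (1600 * (real r)\<^sup>2 / C + 16 * r) * ((ln n / \<sigma>) * (sqrt m / ln n * h))
       + ((6 * r) * (ln n / \<sigma> * 1) + 12 * K * (ln n / \<sigma> * (m / \<sigma>)))"
    by (rule add_mono[OF A B'])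
  also have "\<dots> \<le> (1600 * (real r)\<^sup>2 / C + 16 * r + 6 * r + 12 * K)
      * (ln n / \<sigma> * 1 + ln n / \<sigma> * (m / \<sigma>) + (ln n / \<sigma>) * (sqrt m / ln n * h))"
    using C \<sigma> h ln0 K0 by (intro combine mult_nonneg_nonneg divide_nonneg_nonneg add_nonneg_nonneg) auto
  also have "\<dots> = rate_const r C * (ln n / \<sigma>) * (1 + m / \<sigma> + sqrt m / ln n * h)"
    unfolding rate_const_def K_def by (simp only: distrib_left mult.assoc of_nat_mult of_nat_numeral)
  finally show ?thesis .
qed

text \<open>The non-asymptotic form of the upper bound: the failure probability is explicit and vanishes as
\<open>m\<close> grows.\<close>

lemma (in prob_space) subspace_bound_event:
  fixes r m n :: nat and X :: "real mat"
  defines "\<sigma> \<equiv> singular_value r X"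
  assumes r: "1 \<le> r" and C: "0 < C" and X: "X \<in> carrier_mat m n" and rank: "vec_space.rank m X = r"
    and signal: "C * (real n / sqrt m) \<le> \<sigma>"
    and E: "standard_gaussian_matrix M m n E"
    and V: "leading_right_singular_vectors r X V"
    and Vh: "\<And>\<omega>. \<omega> \<in> space M \<Longrightarrow> leading_right_singular_vectors r (X + E \<omega>) (Vh \<omega>)"
    and W: "\<And>\<omega>. \<omega> \<in> space M \<Longrightarrow> is_procrustes V (Vh \<omega>) (W \<omega>)"
    and mn: "m \<le> n" and ln: "1 \<le> ln (real n)" and large: "40 * sqrt n \<le> C * (real n / sqrt m)"
  shows "\<exists>A\<in>events. A \<subseteq> space M \<and> 1 - (real r + 6) / real m \<le> prob A \<and> (\<forall>\<omega>\<in>A.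
     two_to_inf_norm (Vh \<omega> - V * W \<omega>)
       \<le> r * rate_const r C * (ln n / \<sigma>) * (1 + m / \<sigma> + sqrt m / ln n * two_to_inf_norm V))"
proof -
  obtain U S Wx where svd: "is_svd X U S Wx" and Veq: "V = mat (dim_col X) r (\<lambda>(i,j). Wx $$ (i,j))"
    using V unfolding leading_right_singular_vectors_def by blast
  note D = is_svdD[OF svd X]
  have Veq: "V = leading_cols r Wx" using Veq D(3) X by (simp add: leading_cols_def)
  have rm: "r \<le> min m n" and S0: "\<And>k. r \<le> k \<Longrightarrow> k < min m n \<Longrightarrow> S $$ (k,k) = 0"
    using rank_svd[OF svd X rank] by blast+
  have m1: "1 \<le> m" and rmm: "r \<le> m" and rn: "r \<le> n" using rm r by auto
  have n0: "0 < n" using m1 mn by simp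
  have "singular_value (Suc (r - 1)) X = S $$ (r - 1, r - 1)"
    by (rule singular_value_svd[OF svd]) (use X r rm in auto)
  hence \<sigma>S: "\<sigma> = S $$ (r - 1, r - 1)" using r by (simp add: \<sigma>_def)
  have \<sigma>40: "40 * sqrt n \<le> \<sigma>" using signal large by linarith
  moreover have "0 < sqrt n" using n0 by simp
  ultimately have \<sigma>0: "0 < \<sigma>" by linarith
  have Vc: "V \<in> carrier_mat n r" "V\<^sup>T * V = 1\<^sub>m r"
    unfolding Veq by (rule leading_cols_carrier[OF D(3)], rule orthonormal_leading_cols[OF D(3,4) rn])
  obtain A where A: "A \<in> events" "1 - (real r + 6) / real m \<le> prob A" "A \<subseteq> space M"
    and good: "\<forall>\<omega>\<in>A.
     (\<forall>x\<in>carrier_vec n. norm2_vec (E \<omega> *\<^sub>v x) \<le> 20 * sqrt n * norm2_vec x) \<and>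
     (\<forall>x\<in>carrier_vec r. norm2_vec (E \<omega> *\<^sub>v (V *\<^sub>v x)) \<le> r * (8 * sqrt m) * norm2_vec x) \<and>
     (\<forall>i<m. \<forall>j<n. \<bar>E \<omega> $$ (i,j)\<bar> \<le> 3 * ln n) \<and>
     (\<forall>k<r. \<forall>j<n. \<bar>vec_index ((E \<omega>)\<^sup>T *\<^sub>v col U k) j\<bar> \<le> 3 * ln n)"
    by (rule bexE[OF gaussian_noise_event[OF E m1 mn rmm ln Vc D(1,2)]])
       (elim conjE, rule that; assumption)
  have h0: "0 \<le> two_to_inf_norm V" by (rule two_to_inf_norm_nonneg[OF Vc(1) n0]) (use r in simp)
  show ?thesis
  proof (intro bexI[OF _ A(1)] conjI A(2,3) ballI)
    fix \<omega> assume \<omega>: "\<omega> \<in> A"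
    hence \<omega>M: "\<omega> \<in> space M" using A(3) by blast
    note g = bspec[OF good \<omega>]
    note good1 = g[THEN conjunct1, rule_format]
      and good2 = g[THEN conjunct2, THEN conjunct1, rule_format]
      and good3 = g[THEN conjunct2, THEN conjunct2, THEN conjunct1, rule_format]
      and good4 = g[THEN conjunct2, THEN conjunct2, THEN conjunct2, rule_format]
    have Ec: "E \<omega> \<in> carrier_mat m n" using E \<omega>M unfolding standard_gaussian_matrix_def by blast
    have XE: "X + E \<omega> \<in> carrier_mat m n" using X Ec by simp
    obtain U' S' W' where svd': "is_svd (X + E \<omega>) U' S' W'"
      and Vh_eq: "Vh \<omega> = mat (dim_col (X + E \<omega>)) r (\<lambda>(i,j). W' $$ (i,j))"
      using Vh[OF \<omega>M] unfolding leading_right_singular_vectors_def by blast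
    have W'c: "W' \<in> carrier_mat n n" by (rule is_svdD(3)[OF svd' XE])
    have Vh_eq: "Vh \<omega> = leading_cols r W'" using Vh_eq W'c Ec by (simp add: leading_cols_def)
    obtain W1 S1 W2 where proc: "is_svd (V\<^sup>T * Vh \<omega>) W1 S1 W2" and Weq: "W \<omega> = W1 * W2\<^sup>T"
      using W[OF \<omega>M] unfolding is_procrustes_def by blast
    have Vhc: "Vh \<omega> \<in> carrier_mat n r" unfolding Vh_eq by (rule leading_cols_carrier[OF W'c])
    have VVc: "V\<^sup>T * Vh \<omega> \<in> carrier_mat r r" using Vc(1) Vhc by simp
    have Wc: "W \<omega> \<in> carrier_mat r r" unfolding Weq using is_svdD(1,3)[OF proc VVc] by simp
    hence VW: "V * W \<omega> \<in> carrier_mat n r" using Vc(1) by simp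
    let ?s = "\<sigma> / 2" and ?B = "20 * sqrt n" and ?T = "r * (8 * sqrt m)" and ?L = "3 * ln n"
    have "two_to_inf_norm (Vh \<omega> - V * W \<omega>) \<le> r * (two_to_inf_norm V * ((r * (?B / ?s))\<^sup>2 + ?T / ?s)
        + (r * ?L + sqrt m * ?L * ((?T + ?B * (?B / ?s)) / ?s)) / ?s)"
    proof (rule two_to_inf_norm_le_entries[OF minus_carrier_mat[OF VW] n0])
      fix j k assume jk: "j < n" "k < r"
      show "\<bar>(Vh \<omega> - V * W \<omega>) $$ (j,k)\<bar> \<le> two_to_inf_norm V * ((r * (?B / ?s))\<^sup>2 + ?T / ?s)
        + (r * ?L + sqrt m * ?L * ((?T + ?B * (?B / ?s)) / ?s)) / ?s"
        unfolding Weq Veq Vh_eq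
      proof (rule entrywise_perturbation_bound[OF X Ec svd svd' _ rm S0])
        show "is_svd ((leading_cols r Wx)\<^sup>T * leading_cols r W') W1 S1 W2"
          using proc unfolding Veq Vh_eq .
        show "2 * ?s \<le> S $$ (r - 1, r - 1)" using \<sigma>S by simp
        show "?B \<le> ?s" using \<sigma>40 by simp
        show "0 \<le> ?L" using ln by linarith
        show "0 < ?s" using \<sigma>0 by simp
        show "0 < r" using r by simp
        show "norm2_vec (E \<omega> *\<^sub>v (leading_cols r Wx *\<^sub>v x)) \<le> ?T * norm2_vec x"
          if "x \<in> carrier_vec r" for x using good2[OF that] unfolding Veq .
      qed (use jk in \<open>simp_all add: good1 good3 good4 del: index_mult_mat_vec\<close>)
    qed (use r in simp)
    also have "\<dots> \<le> r * (rate_const r C * (ln n / \<sigma>) * (1 + m / \<sigma> + sqrt m / ln n * two_to_inf_norm V))"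
      by (intro mult_left_mono rate_arithmetic[OF C \<sigma>0 h0 ln m1 signal]) simp
    finally show "two_to_inf_norm (Vh \<omega> - V * W \<omega>)
       \<le> r * rate_const r C * (ln n / \<sigma>) * (1 + m / \<sigma> + sqrt m / ln n * two_to_inf_norm V)"
      by (simp only: mult.assoc)
  qed
qed

text \<open>For finitely many indices the event may be replaced by the empty set, so the implication is required
only eventually.\<close>

lemma with_high_probability_mono:
  assumes P: "with_high_probability M P"
    and Q: "eventually (\<lambda>n. \<forall>\<omega>\<in>space (M n). P n \<omega> \<longrightarrow> Q n \<omega>) sequentially"
  shows "with_high_probability M Q"
proof -
  obtain A where A: "\<And>n. A n \<in> sets (M n)" "\<And>n \<omega>. \<omega> \<in> A n \<Longrightarrow> P n \<omega>" "(\<lambda>n. measure (M n) (A n)) \<longlonglongrightarrow> 1"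
    using P unfolding with_high_probability_def by blast
  let ?g = "\<lambda>n. \<forall>\<omega>\<in>space (M n). P n \<omega> \<longrightarrow> Q n \<omega>"
  define A' where "A' n = (if ?g n then A n else {})" for n
  have "(\<lambda>n. measure (M n) (A' n)) \<longlonglongrightarrow> 1"
    by (rule Lim_transform_eventually[OF A(3)]) (use Q in eventually_elim, simp add: A'_def)
  moreover have "A' n \<in> sets (M n)" for n using A(1) by (simp add: A'_def)
  moreover have "Q n \<omega>" if "\<omega> \<in> A' n" for n \<omega>
    using that A(1)[of n, THEN sets.sets_into_space] A(2) by (auto simp: A'_def split: if_splits)
  ultimately show ?thesis unfolding with_high_probability_def by blast
qed

text \<open>The last inequality makes the noise level \<open>20 * sqrt n\<close> at most half of the smallest nonzero
singular value, as Weyl's inequality requires.\<close>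

lemma eventually_dimension_regime:
  fixes p1 p2 :: "nat \<Rightarrow> nat"
  assumes p1: "filterlim p1 at_top sequentially" and ratio: "(\<lambda>n. real (p1 n) / real (p2 n)) \<longlonglongrightarrow> 0"
    and p2: "\<And>n. 0 < p2 n" and C: "0 < C"
  shows "eventually (\<lambda>n. p1 n \<le> p2 n \<and> 1 \<le> ln (real (p2 n))
    \<and> 40 * sqrt (p2 n) \<le> C * (real (p2 n) / sqrt (p1 n))) sequentially"
proof -
  have "eventually (\<lambda>n. 3 \<le> p1 n) sequentially" using p1 by (simp add: filterlim_at_top)
  moreover have "eventually (\<lambda>n. real (p1 n) / real (p2 n) < min 1 ((C / 40)\<^sup>2)) sequentially"
    by (rule order_tendstoD(2)[OF ratio]) (use C in simp)
  ultimately show ?thesis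
  proof eventually_elim
    case (elim n)
    have n0: "0 < real (p2 n)" using p2 by simp
    have m0: "0 < real (p1 n)" using elim(1) by simp
    have "real (p1 n) \<le> real (p2 n)" using elim(2) n0 by (simp add: pos_divide_less_eq)
    hence le: "p1 n \<le> p2 n" by simp
    have "exp 1 \<le> (3::real)" by (rule exp_le)
    also have "\<dots> \<le> real (p2 n)" using elim(1) le by simp
    finally have ln: "1 \<le> ln (real (p2 n))" using n0 by (simp add: ln_ge_iff)
    have "real (p1 n) / real (p2 n) \<le> (C / 40)\<^sup>2" using elim(2) by simp
    hence "sqrt (real (p1 n) / real (p2 n)) \<le> C / 40" using C by (intro real_le_lsqrt) auto
    hence "40 * sqrt (p1 n) \<le> C * sqrt (p2 n)" using n0 by (simp add: real_sqrt_divide field_simps)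
    hence "40 * sqrt (p1 n) * sqrt (p2 n) \<le> C * sqrt (p2 n) * sqrt (p2 n)" by (rule mult_right_mono) simp
    hence "40 * sqrt (p2 n) \<le> C * (real (p2 n) / sqrt (p1 n))" using m0 n0 by (simp add: field_simps)
    with le ln show ?case by blast
  qed
qed

lemma model_rank_le:
  assumes "gaussian_perturbation_model r C M p1 p2 X E V Vh W"
  shows "r \<le> min (p1 n) (p2 n)"
proof -
  obtain U S W where svd: "is_svd (X n) U S W"
    using assms unfolding gaussian_perturbation_model_def leading_right_singular_vectors_def by blast
  show ?thesis by (rule rank_svd(1)[OF svd]) (use assms in \<open>auto simp: gaussian_perturbation_model_def\<close>)
qed

lemma perturbation_bound_whp:
  assumes r: "1 \<le> r" and C: "0 < C"
    and model: "gaussian_perturbation_model r C M p1 p2 X E V Vh W"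
  shows "with_high_probability M (\<lambda>n \<omega>.
     two_to_inf_norm (Vh n \<omega> - V n * W n \<omega>)
       \<le> r * rate_const r C * (ln (real (p2 n)) / singular_value r (X n)) *
          (1 + real (p1 n) / singular_value r (X n)
             + sqrt (real (p1 n)) / ln (real (p2 n)) * two_to_inf_norm (V n)))"
    (is "with_high_probability M ?P")
proof -
  have p1: "filterlim p1 at_top sequentially" and ratio: "(\<lambda>n. real (p1 n) / real (p2 n)) \<longlonglongrightarrow> 0"
    and ps: "\<And>n. prob_space (M n)" and X: "\<And>n. X n \<in> carrier_mat (p1 n) (p2 n)"
    and rank: "\<And>n. vec_space.rank (p1 n) (X n) = r"
    and signal: "\<And>n. C * (real (p2 n) / sqrt (real (p1 n))) \<le> singular_value r (X n)"
    and E: "\<And>n. standard_gaussian_matrix (M n) (p1 n) (p2 n) (E n)"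
    and V: "\<And>n. leading_right_singular_vectors r (X n) (V n)"
    and Vh: "\<And>n \<omega>. \<omega> \<in> space (M n) \<Longrightarrow> leading_right_singular_vectors r (X n + E n \<omega>) (Vh n \<omega>)"
    and W: "\<And>n \<omega>. \<omega> \<in> space (M n) \<Longrightarrow> is_procrustes (V n) (Vh n \<omega>) (W n \<omega>)"
    using model unfolding gaussian_perturbation_model_def by blast+
  have p2: "0 < p2 n" for n using model_rank_le[OF model, of n] r by simp
  let ?good = "\<lambda>n. p1 n \<le> p2 n \<and> 1 \<le> ln (real (p2 n)) \<and> 40 * sqrt (p2 n) \<le> C * (real (p2 n) / sqrt (p1 n))"
  have ev: "eventually ?good sequentially" by (rule eventually_dimension_regime[OF p1 ratio p2 C])
  have "\<exists>A. A \<in> sets (M n) \<and> (\<forall>\<omega>\<in>A. ?P n \<omega>) \<and> (?good n \<longrightarrow> 1 - (real r + 6) / real (p1 n) \<le> measure (M n) A)" for n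
  proof (cases "?good n")
    case True
    interpret prob_space "M n" by (rule ps)
    from subspace_bound_event[OF r C X rank signal E V Vh W] True show ?thesis by blast
  next
    case False
    thus ?thesis by (intro exI[of _ "{}"]) auto
  qed
  then obtain A where A: "\<And>n. A n \<in> sets (M n)" "\<And>n \<omega>. \<omega> \<in> A n \<Longrightarrow> ?P n \<omega>"
    "\<And>n. ?good n \<Longrightarrow> 1 - (real r + 6) / real (p1 n) \<le> measure (M n) (A n)"
    by metis
  have "filterlim (\<lambda>n. real (p1 n)) at_top sequentially"
    by (rule filterlim_compose[OF filterlim_real_sequentially p1])
  hence "(\<lambda>n. 1 - (real r + 6) / real (p1 n)) \<longlonglongrightarrow> 1 - 0"
    by (intro tendsto_diff tendsto_const tendsto_divide_0[OF tendsto_const] filterlim_at_top_imp_at_infinity)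
  hence lower: "(\<lambda>n. 1 - (real r + 6) / real (p1 n)) \<longlonglongrightarrow> 1" by simp
  have "(\<lambda>n. measure (M n) (A n)) \<longlonglongrightarrow> 1"
  proof (rule tendsto_sandwich[OF _ _ lower tendsto_const])
    show "eventually (\<lambda>n. 1 - (real r + 6) / real (p1 n) \<le> measure (M n) (A n)) sequentially"
      using ev by eventually_elim (rule A(3))
    show "eventually (\<lambda>n. measure (M n) (A n) \<le> 1) sequentially"
      by (intro always_eventually allI prob_space.prob_le_1 ps)
  qed
  with A(1,2) show ?thesis unfolding with_high_probability_def by blast
qed

lemma incoherent_perturbation_bound_whp:
  assumes r: "1 \<le> r" and C: "0 < C" and c: "0 < c" and cr: "0 < cr"
    and model: "gaussian_perturbation_model r C M p1 p2 X E V Vh W"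
    and strong: "\<And>n. c * real (p1 n) \<le> singular_value r (X n)"
    and incoherent: "\<And>n. two_to_inf_norm (V n) \<le> cr / sqrt (real (p2 n))"
  shows "with_high_probability M (\<lambda>n \<omega>.
     two_to_inf_norm (Vh n \<omega> - V n * W n \<omega>)
       \<le> r * rate_const r C * (1 + 1 / c + cr) * (ln (real (p2 n)) / singular_value r (X n)))"
proof (rule with_high_probability_mono[OF perturbation_bound_whp[OF r C model]])
  have p12: "0 < p1 n" "0 < p2 n" for n using model_rank_le[OF model, of n] r by auto
  have "eventually (\<lambda>n. p1 n \<le> p2 n \<and> 1 \<le> ln (real (p2 n))
    \<and> 40 * sqrt (p2 n) \<le> C * (real (p2 n) / sqrt (p1 n))) sequentially"
    by (rule eventually_dimension_regime[OF _ _ p12(2) C])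
       (use model in \<open>auto simp: gaussian_perturbation_model_def\<close>)
  thus "eventually (\<lambda>n. \<forall>\<omega>\<in>space (M n).
     two_to_inf_norm (Vh n \<omega> - V n * W n \<omega>)
       \<le> r * rate_const r C * (ln (real (p2 n)) / singular_value r (X n)) *
          (1 + real (p1 n) / singular_value r (X n)
             + sqrt (real (p1 n)) / ln (real (p2 n)) * two_to_inf_norm (V n)) \<longrightarrow>
     two_to_inf_norm (Vh n \<omega> - V n * W n \<omega>)
       \<le> r * rate_const r C * (1 + 1 / c + cr) * (ln (real (p2 n)) / singular_value r (X n))) sequentially"
  proof eventually_elim
    case (elim n)
    define \<sigma> where "\<sigma> = singular_value r (X n)"
    have m0: "0 < real (p1 n)" and n0: "0 < real (p2 n)" using p12 by auto
    have \<sigma>0: "0 < \<sigma>" using strong[of n] mult_pos_pos[OF c m0] unfolding \<sigma>_def by linarith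
    have ln: "1 \<le> ln (real (p2 n))" using elim by blast
    have 1: "real (p1 n) / \<sigma> \<le> 1 / c"
      using strong[of n] c \<sigma>0 by (simp add: \<sigma>_def field_simps)
    have "sqrt (real (p1 n)) / ln (real (p2 n)) * two_to_inf_norm (V n)
        \<le> sqrt (real (p1 n)) / ln (real (p2 n)) * (cr / sqrt (real (p2 n)))"
      using ln by (intro mult_left_mono incoherent) auto
    also have "\<dots> \<le> sqrt (real (p1 n)) / 1 * (cr / sqrt (real (p2 n)))"
      using ln cr by (intro mult_right_mono divide_left_mono) auto
    also have "\<dots> \<le> sqrt (real (p2 n)) * (cr / sqrt (real (p2 n)))"
      using elim cr by (intro mult_right_mono) auto
    also have "\<dots> = cr" using n0 by simp
    finally have 2: "sqrt (real (p1 n)) / ln (real (p2 n)) * two_to_inf_norm (V n) \<le> cr" .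
    have "0 \<le> r * rate_const r C * (ln (real (p2 n)) / \<sigma>)"
      using rate_const_pos[of r C] r C ln \<sigma>0 by (intro mult_nonneg_nonneg divide_nonneg_nonneg) auto
    hence "r * rate_const r C * (ln (real (p2 n)) / \<sigma>) *
        (1 + real (p1 n) / \<sigma> + sqrt (real (p1 n)) / ln (real (p2 n)) * two_to_inf_norm (V n))
      \<le> r * rate_const r C * (ln (real (p2 n)) / \<sigma>) * (1 + 1 / c + cr)"
      using 1 2 by (intro mult_left_mono) auto
    thus ?case unfolding \<sigma>_def[symmetric] by (auto simp: mult_ac)
  qed
qed

section \<open>Lower bound\<close>

text \<open>Passing from maximal row norm to operator norm costs at most $\sqrt n$, and on each singular vector of
\<open>V\<^sup>T * Vh\<close> the squared lengths satisfy $1 - c^2 \le 2 - 2c$ because $(1 - c)^2 \ge 0$.\<close>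

lemma sin_Theta_lower_bound:
  assumes V: "V \<in> carrier_mat n r" "V\<^sup>T * V = 1\<^sub>m r" and Vh: "Vh \<in> carrier_mat n r" "Vh\<^sup>T * Vh = 1\<^sub>m r"
    and proc: "is_procrustes V Vh W" and n: "0 < n" and r: "0 < r"
  shows "1 / sqrt n * spectral_norm (sin_Theta Vh V) \<le> two_to_inf_norm (Vh - V * W)"
proof -
  obtain W1 S W2 where svd: "is_svd (V\<^sup>T * Vh) W1 S W2" and W: "W = W1 * W2\<^sup>T"
    using proc unfolding is_procrustes_def by blast
  have A: "V\<^sup>T * Vh \<in> carrier_mat r r" using V(1) Vh(1) by simp
  have "W \<in> carrier_mat r r" unfolding W using is_svdD(1,3)[OF svd A] by simp
  hence VW: "V * W \<in> carrier_mat n r" using V(1) by simp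
  define G where "G = Vh - V * W"
  have G: "G \<in> carrier_mat n r" unfolding G_def by (rule minus_carrier_mat[OF VW])
  define t where "t = sqrt n * two_to_inf_norm G"
  have t0: "0 \<le> t" unfolding t_def using two_to_inf_norm_nonneg[OF G n r] by simp
  define d where "d i = sin (arccos (singular_value (i + 1) (V\<^sup>T * Vh)))" for i
  have d: "(d i)\<^sup>2 \<le> t\<^sup>2" if i: "i < r" for i
  proof -
    note P = procrustes_singular_vector[OF V Vh svd i]
    have "singular_value (i + 1) (V\<^sup>T * Vh) = S $$ (i,i)"
      using singular_value_svd[OF svd, of i] V(1) Vh(1) i by simp
    hence "d i = sqrt (1 - (S $$ (i,i))\<^sup>2)" unfolding d_def using P(5,6) by (simp add: sin_arccos)
    moreover have s1: "(S $$ (i,i))\<^sup>2 \<le> 1" using P(5,6) by (simp add: power_le_one)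
    ultimately have "(d i)\<^sup>2 = 1 - (S $$ (i,i))\<^sup>2" by simp
    also have "\<dots> \<le> 2 - 2 * S $$ (i,i)"
      using zero_le_power2[of "1 - S $$ (i,i)"] by (simp add: power2_diff)
    also have "\<dots> = (norm2_vec (G *\<^sub>v col W2 i))\<^sup>2" unfolding G_def W by (rule P(4)[symmetric])
    also have "\<dots> \<le> t\<^sup>2"
      unfolding t_def by (intro power_mono norm2_le_sqrt_two_to_inf_norm[OF G P(1,2) n r]) simp
    finally show ?thesis .
  qed
  have T: "sin_Theta Vh V = mat r r (\<lambda>(i,j). if i = j then d i else 0)"
    unfolding sin_Theta_def d_def using V(1) by simp
  have "spectral_norm (sin_Theta Vh V) \<le> t"
    unfolding spectral_norm_def
  proof (rule cSUP_least)
    have "unit_vec r 0 \<in> unit_vecs (dim_col (sin_Theta Vh V))"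
      unfolding T using norm2_vec_unit_vec[OF r] by (simp add: unit_vecs_def)
    thus "unit_vecs (dim_col (sin_Theta Vh V)) \<noteq> {}" by blast
    fix x assume "x \<in> unit_vecs (dim_col (sin_Theta Vh V))"
    hence x: "x \<in> carrier_vec r" "norm2_vec x = 1" unfolding T by (auto simp: unit_vecs_def)
    have ent: "vec_index (sin_Theta Vh V *\<^sub>v x) i = d i * vec_index x i" if i: "i < r" for i
    proof -
      have "vec_index (sin_Theta Vh V *\<^sub>v x) i = (\<Sum>j<r. (if i = j then d i else 0) * vec_index x j)"
        unfolding T using i x(1) by (simp add: scalar_prod_def atLeast0LessThan)
      also have "\<dots> = (\<Sum>j<r. if j = i then d i * vec_index x i else 0)" by (intro sum.cong) auto
      finally show ?thesis using i by simp
    qed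
    have "(norm2_vec (sin_Theta Vh V *\<^sub>v x))\<^sup>2 = (\<Sum>i<r. (vec_index (sin_Theta Vh V *\<^sub>v x) i)\<^sup>2)"
      unfolding norm2_vec_def by (simp add: sum_nonneg T)
    also have "\<dots> = (\<Sum>i<r. (d i)\<^sup>2 * (vec_index x i)\<^sup>2)"
      by (intro sum.cong refl) (simp only: lessThan_iff ent power_mult_distrib)
    also have "\<dots> \<le> (\<Sum>i<r. t\<^sup>2 * (vec_index x i)\<^sup>2)" using d by (intro sum_mono mult_right_mono) auto
    also have "\<dots> = t\<^sup>2 * (norm2_vec x)\<^sup>2"
      using x(1) by (simp add: norm2_vec_def sum_nonneg sum_distrib_left)
    also have "\<dots> = t\<^sup>2" using x(2) by simp
    finally show "norm2_vec (sin_Theta Vh V *\<^sub>v x) \<le> t" by (rule power2_le_imp_le[OF _ t0])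
  qed
  hence "1 / sqrt n * spectral_norm (sin_Theta Vh V) \<le> 1 / sqrt n * t" by (intro mult_left_mono) auto
  also have "\<dots> = two_to_inf_norm (Vh - V * W)" using n by (simp add: t_def G_def)
  finally show ?thesis .
qed

lemma leading_right_singular_vectors_orthonormal:
  assumes "leading_right_singular_vectors r A V" and A: "A \<in> carrier_mat m n" and r: "r \<le> n"
  shows "V \<in> carrier_mat n r" "V\<^sup>T * V = 1\<^sub>m r"
proof -
  obtain U S W where svd: "is_svd A U S W" and "V = mat (dim_col A) r (\<lambda>(i,j). W $$ (i,j))"
    using assms unfolding leading_right_singular_vectors_def by blast
  hence V: "V = leading_cols r W" using A is_svdD(3)[OF svd A] by (simp add: leading_cols_def)
  show "V \<in> carrier_mat n r" "V\<^sup>T * V = 1\<^sub>m r"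
    unfolding V by (rule leading_cols_carrier[OF is_svdD(3)[OF svd A]],
      rule orthonormal_leading_cols[OF is_svdD(3,4)[OF svd A] r])
qed

section \<open>Perturbation of the leading right singular subspace\<close>

theorem theorem4p3:
  fixes r :: nat and C :: real
  assumes "1 \<le> r" and "0 < C"
  shows
    "(\<exists>Cr>0. \<forall>(M :: nat \<Rightarrow> 'a measure) p1 p2 X E V Vh W.
        gaussian_perturbation_model r C M p1 p2 X E V Vh W \<longrightarrow>
        with_high_probability M (\<lambda>n \<omega>.
          two_to_inf_norm (Vh n \<omega> - V n * W n \<omega>)
            \<le> Cr * (ln (real (p2 n)) / singular_value r (X n)) *
               (1 + real (p1 n) / singular_value r (X n)
                  + sqrt (real (p1 n)) / ln (real (p2 n)) * two_to_inf_norm (V n)))) \<and>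
     (\<forall>c>0. \<forall>cr>0. \<exists>Cr>0. \<forall>(M :: nat \<Rightarrow> 'a measure) p1 p2 X E V Vh W.
        gaussian_perturbation_model r C M p1 p2 X E V Vh W \<and>
        (\<forall>n. c * real (p1 n) \<le> singular_value r (X n)) \<and>
        (\<forall>n. two_to_inf_norm (V n) \<le> cr / sqrt (real (p2 n))) \<longrightarrow>
        with_high_probability M (\<lambda>n \<omega>.
          two_to_inf_norm (Vh n \<omega> - V n * W n \<omega>)
            \<le> Cr * (ln (real (p2 n)) / singular_value r (X n)))) \<and>
     (\<forall>(M :: nat \<Rightarrow> 'a measure) p1 p2 X E V Vh W.
        gaussian_perturbation_model r C M p1 p2 X E V Vh W \<longrightarrow>
        (\<forall>n. \<forall>\<omega>\<in>space (M n).
          1 / sqrt (real (p2 n)) * spectral_norm (sin_Theta (Vh n \<omega>) (V n))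
            \<le> two_to_inf_norm (Vh n \<omega> - V n * W n \<omega>)))"
proof (intro conjI allI impI ballI)
  have pos: "0 < real r * rate_const r C" using rate_const_pos[of r C] assms by simp
  show "\<exists>Cr>0. \<forall>(M :: nat \<Rightarrow> 'a measure) p1 p2 X E V Vh W.
        gaussian_perturbation_model r C M p1 p2 X E V Vh W \<longrightarrow>
        with_high_probability M (\<lambda>n \<omega>.
          two_to_inf_norm (Vh n \<omega> - V n * W n \<omega>)
            \<le> Cr * (ln (real (p2 n)) / singular_value r (X n)) *
               (1 + real (p1 n) / singular_value r (X n)
                  + sqrt (real (p1 n)) / ln (real (p2 n)) * two_to_inf_norm (V n)))"
    by (intro exI[of _ "real r * rate_const r C"] conjI allI impI pos perturbation_bound_whp assms)
next
  fix c cr :: real assume c: "0 < c" and cr: "0 < cr"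
  have "0 < real r * rate_const r C * (1 + 1 / c + cr)"
    using rate_const_pos[of r C] assms c cr by (intro mult_pos_pos add_pos_pos) auto
  thus "\<exists>Cr>0. \<forall>(M :: nat \<Rightarrow> 'a measure) p1 p2 X E V Vh W.
        gaussian_perturbation_model r C M p1 p2 X E V Vh W \<and>
        (\<forall>n. c * real (p1 n) \<le> singular_value r (X n)) \<and>
        (\<forall>n. two_to_inf_norm (V n) \<le> cr / sqrt (real (p2 n))) \<longrightarrow>
        with_high_probability M (\<lambda>n \<omega>.
          two_to_inf_norm (Vh n \<omega> - V n * W n \<omega>)
            \<le> Cr * (ln (real (p2 n)) / singular_value r (X n)))"
    using incoherent_perturbation_bound_whp[OF assms c cr] by blast
next
  fix M :: "nat \<Rightarrow> 'a measure" and p1 p2 X E V Vh W n \<omega>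
  assume model: "gaussian_perturbation_model r C M p1 p2 X E V Vh W" and \<omega>: "\<omega> \<in> space (M n)"
  have X: "X n \<in> carrier_mat (p1 n) (p2 n)" and E: "E n \<omega> \<in> carrier_mat (p1 n) (p2 n)"
    and V: "leading_right_singular_vectors r (X n) (V n)"
    and Vh: "leading_right_singular_vectors r (X n + E n \<omega>) (Vh n \<omega>)"
    and W: "is_procrustes (V n) (Vh n \<omega>) (W n \<omega>)"
    using model \<omega> unfolding gaussian_perturbation_model_def standard_gaussian_matrix_def by blast+
  have r: "0 < r" "r \<le> p2 n" using model_rank_le[OF model, of n] assms(1) by auto
  have XE: "X n + E n \<omega> \<in> carrier_mat (p1 n) (p2 n)" using X E by simp
  show "1 / sqrt (real (p2 n)) * spectral_norm (sin_Theta (Vh n \<omega>) (V n))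
            \<le> two_to_inf_norm (Vh n \<omega> - V n * W n \<omega>)"
    by (rule sin_Theta_lower_bound[OF leading_right_singular_vectors_orthonormal[OF V X r(2)]
          leading_right_singular_vectors_orthonormal[OF Vh XE r(2)] W _ r(1)]) (use r in simp)
qed

end
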